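(* Let $\mathbb{k}\in\{\mathbb{R},\mathbb{C}\}$. The functors $D_w:\mathsf{TVS}_w\to\mathsf{TVS}_w^{\mathrm{op}}$ and $D_m:\mathsf{TVS}_m\to\mathsf{TVS}_m^{\mathrm{op}}$ satisfy $$D_w(V)=(V',\sigma(V',V))\ \ (V\in\mathsf{TVS}_w)\qquad\text{and}\qquad D_m(V)=(V',\tau(V',V))\ \ (V\in\mathsf{TVS}_m).$$ Moreover, $D_w^2\cong\mathrm{id}_{\mathsf{TVS}_w}$ and $D_m^2\cong\mathrm{id}_{\mathsf{TVS}_m}$.
   Context: $\mathsf{TVS}$ is the category of Hausdorff locally convex topological $\mathbb{k}$-vector spaces and continuous linear maps; $V'$ is the space of continuous linear functionals on $V$. $\mathsf{chu}$ is the category of triples $(V,W,\langle-,-\rangle)$ with $V,W$ vector spaces and $\langle-,-\rangle: V\otimes_{\mathbb{k}}W\to\mathbb{k}$ linear such that both $V\to W^\star$ and $W\to V^\star$ are injective; a morphism $(V_1,W_1)\to(V_2,W_2)$ is a pair of linear maps $f: V_1\to V_2$, $g: W_2\to W_1$ with $\langle f(v),w\rangle_2=\langle v,g(w)\rangle_1$. The duality on $\mathsf{chu}$ is $(V,W,\langle-,-\rangle)^\star=(W,V,\langle-,-\rangle)$ with arguments swapped, and $(f,g)^\star=(g,f)$. For a pair $(V,W)\in\mathsf{chu}$, a dual topology on $V$ is a Hausdorff locally convex topology for which $W\to V^\star$ induces an isomorphism of $W$ onto the topological dual; $\sigma(V,W)$ is the weakest and $\tau(V,W)$ the strongest dual topology.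 $\sigma(V',V)$ and $\tau(V',V)$ are taken with respect to the pair $(V',V)$ with the evaluation pairing. $\mathsf{TVS}_w$ (resp. $\mathsf{TVS}_m$) is the full subcategory of $\mathsf{TVS}$ of spaces whose topology is $\sigma(V,V')$ (resp. $\tau(V,V')$). $T_w,T_m$ send $V$ to $(V,V',\mathrm{eval})$ and $f$ to $(f,f^\star)$; $R(V,W)=(V,\sigma(V,W))$, $L(V,W)=(V,\tau(V,W))$, and $R(f,g)=L(f,g)=f$. By definition $D_w(V)=R((T_wV)^\star)$ and $D_m(V)=L((T_mV)^\star)$. $D_w^2$ and $D_m^2$ denote the (covariant) double duals. *)

theory Defs
  imports "HOL-Analysis.Analysis" "HOL-Algebra.Algebraic_Closure_Type"
begin

text \<open>The class of scalar fields: the fields isometrically isomorphic to the reals or to the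
  complex numbers.\<close>

class real_or_complex = real_normed_field +
  assumes real_or_complex:
    "(\<exists>h :: 'a \<Rightarrow> real. bij h \<and> (\<forall>x y. h (x + y) = h x + h y) \<and> (\<forall>x y. h (x * y) = h x * h y) \<and>
        (\<forall>x. norm (h x) = norm x)) \<or>
     (\<exists>h :: 'a \<Rightarrow> complex. bij h \<and> (\<forall>x y. h (x + y) = h x + h y) \<and> (\<forall>x y. h (x * y) = h x * h y) \<and>
        (\<forall>x. norm (h x) = norm x))"

instance real :: real_or_complex
  by standard (rule disjI1, rule exI[of _ "\<lambda>x. x"], simp add: bij_def)

instance complex :: real_or_complex
  by standard (rule disjI2, rule exI[of _ "\<lambda>x. x"], simp add: bij_def)

text \<open>Vector spaces over \<open>'k\<close> are modules over \<^term>\<open>ring_of_type_algebra\<close>, the type \<open>'k\<close> viewed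
  as a ring structure; the fields \<^const>\<open>mult\<close> and \<^const>\<open>one\<close> of the module record are irrelevant.
  Maps between carriers are extensional (undefined outside the domain), so that two
  linear maps are equal in HOL iff they agree on the carrier, and composition and identities are
  \<^const>\<open>compose\<close> and \<^const>\<open>restrict\<close>.\<close>

definition vec_space :: "('k::real_or_complex, 'a) module \<Rightarrow> bool" where
  "vec_space V \<longleftrightarrow> module (ring_of_type_algebra :: 'k ring) V"

definition linear_maps ::
    "('k::real_or_complex, 'a) module \<Rightarrow> ('k, 'b) module \<Rightarrow> ('a \<Rightarrow> 'b) set" where
  "linear_maps V W = {f \<in> carrier V \<rightarrow>\<^sub>E carrier W.
     (\<forall>x\<in>carrier V. \<forall>y\<in>carrier V. f (x \<oplus>\<^bsub>V\<^esub> y) = f x \<oplus>\<^bsub>W\<^esub> f y) \<and>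
     (\<forall>c. \<forall>x\<in>carrier V. f (c \<odot>\<^bsub>V\<^esub> x) = c \<odot>\<^bsub>W\<^esub> f x)}"

definition scalar_module :: "('k::real_or_complex, 'k) module" where
  "scalar_module = \<lparr>carrier = UNIV, mult = (*), one = 1, zero = 0, add = (+), smult = (*)\<rparr>"

definition alg_dual :: "('k::real_or_complex, 'a) module \<Rightarrow> ('k, 'a \<Rightarrow> 'k) module" where
  "alg_dual V =
     \<lparr>carrier = linear_maps V scalar_module, mult = undefined, one = undefined,
      zero = (\<lambda>x\<in>carrier V. 0),
      add = (\<lambda>\<phi> \<psi>. \<lambda>x\<in>carrier V. \<phi> x + \<psi> x),
      smult = (\<lambda>c \<phi>. \<lambda>x\<in>carrier V. c * \<phi> x)\<rparr>"

definition convex_in :: "('k::real_or_complex, 'a) module \<Rightarrow> 'a set \<Rightarrow> bool" where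
  "convex_in V C \<longleftrightarrow> C \<subseteq> carrier V \<and>
     (\<forall>x\<in>C. \<forall>y\<in>C. \<forall>t::real. 0 \<le> t \<and> t \<le> 1 \<longrightarrow>
        of_real t \<odot>\<^bsub>V\<^esub> x \<oplus>\<^bsub>V\<^esub> of_real (1 - t) \<odot>\<^bsub>V\<^esub> y \<in> C)"

type_synonym ('k, 'a) tvs = "('k, 'a) module \<times> 'a topology"

definition TVS :: "('k::real_or_complex, 'a) tvs set" where
  "TVS = {(V, T). vec_space V \<and> topspace T = carrier V \<and>
     continuous_map (prod_topology T T) T (\<lambda>(x, y). x \<oplus>\<^bsub>V\<^esub> y) \<and>
     continuous_map (prod_topology euclidean T) T (\<lambda>(c, x). c \<odot>\<^bsub>V\<^esub> x) \<and>
     Hausdorff_space T \<and>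
     neighbourhood_base_at \<zero>\<^bsub>V\<^esub> (convex_in V) T}"

fun tvs_hom :: "('k::real_or_complex, 'a) tvs \<Rightarrow> ('k, 'b) tvs \<Rightarrow> ('a \<Rightarrow> 'b) set" where
  "tvs_hom (V, S) (W, T) = {f \<in> linear_maps V W. continuous_map S T f}"

definition tvs_id :: "('k::real_or_complex, 'a) tvs \<Rightarrow> 'a \<Rightarrow> 'a" where
  "tvs_id V = (\<lambda>x\<in>carrier (fst V). x)"

definition tvs_comp ::
    "('k::real_or_complex, 'a) tvs \<Rightarrow> ('b \<Rightarrow> 'c) \<Rightarrow> ('a \<Rightarrow> 'b) \<Rightarrow> 'a \<Rightarrow> 'c" where
  "tvs_comp V g f = compose (carrier (fst V)) g f"

definition tvs_iso :: "('k::real_or_complex, 'a) tvs \<Rightarrow> ('k, 'b) tvs \<Rightarrow> ('a \<Rightarrow> 'b) \<Rightarrow> bool" where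
  "tvs_iso V W f \<longleftrightarrow> f \<in> tvs_hom V W \<and>
     (\<exists>g\<in>tvs_hom W V. tvs_comp V g f = tvs_id V \<and> tvs_comp W f g = tvs_id W)"

fun top_dual :: "('k::real_or_complex, 'a) tvs \<Rightarrow> ('k, 'a \<Rightarrow> 'k) module" where
  "top_dual (V, T) =
     (alg_dual V)\<lparr>carrier := {\<phi> \<in> carrier (alg_dual V). continuous_map T euclidean \<phi>}\<rparr>"

text \<open>Objects of chu. A linear form on the tensor product of \<open>V\<close> and \<open>W\<close> is given as a bilinear
  form; the values of \<open>p\<close> outside the carriers are irrelevant.\<close>

type_synonym ('k, 'a, 'b) chu = "('k, 'a) module \<times> ('k, 'b) module \<times> ('a \<Rightarrow> 'b \<Rightarrow> 'k)"

definition CHU :: "('k::real_or_complex, 'a, 'b) chu set" where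
  "CHU = {(V, W, p). vec_space V \<and> vec_space W \<and>
     (\<forall>v\<in>carrier V. (\<lambda>w\<in>carrier W. p v w) \<in> carrier (alg_dual W)) \<and>
     (\<forall>w\<in>carrier W. (\<lambda>v\<in>carrier V. p v w) \<in> carrier (alg_dual V)) \<and>
     inj_on (\<lambda>v. \<lambda>w\<in>carrier W. p v w) (carrier V) \<and>
     inj_on (\<lambda>w. \<lambda>v\<in>carrier V. p v w) (carrier W)}"

fun chu_dual :: "('k::real_or_complex, 'a, 'b) chu \<Rightarrow> ('k, 'b, 'a) chu" where
  "chu_dual (V, W, p) = (W, V, \<lambda>w v. p v w)"

fun chu_dual_mor :: "('a \<Rightarrow> 'c) \<times> ('d \<Rightarrow> 'b) \<Rightarrow> ('d \<Rightarrow> 'b) \<times> ('a \<Rightarrow> 'c)" where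
  "chu_dual_mor (f, g) = (g, f)"

fun dual_topology :: "('k::real_or_complex, 'a, 'b) chu \<Rightarrow> 'a topology \<Rightarrow> bool" where
  "dual_topology (V, W, p) T \<longleftrightarrow> (V, W, p) \<in> CHU \<and> (V, T) \<in> TVS \<and>
     (\<lambda>w\<in>carrier W. \<lambda>v\<in>carrier V. p v w) \<in> linear_maps W (top_dual (V, T)) \<and>
     bij_betw (\<lambda>w. \<lambda>v\<in>carrier V. p v w) (carrier W) (carrier (top_dual (V, T)))"

definition weaker_top :: "'a topology \<Rightarrow> 'a topology \<Rightarrow> bool" where
  "weaker_top S T \<longleftrightarrow> (\<forall>U. openin S U \<longrightarrow> openin T U)"

definition sigma_top :: "('k::real_or_complex, 'a, 'b) chu \<Rightarrow> 'a topology" where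
  "sigma_top P =
     (THE T. dual_topology P T \<and> (\<forall>S. dual_topology P S \<longrightarrow> weaker_top T S))"

definition tau_top :: "('k::real_or_complex, 'a, 'b) chu \<Rightarrow> 'a topology" where
  "tau_top P =
     (THE T. dual_topology P T \<and> (\<forall>S. dual_topology P S \<longrightarrow> weaker_top S T))"

text \<open>\<open>T_chu\<close> is the common formula of the functors \<open>T_w\<close> and \<open>T_m\<close>. The object maps
  are polymorphic in the types of the carriers, so a morphism map takes the source
  and target of the morphism as arguments.\<close>

definition T_chu :: "('k::real_or_complex, 'a) tvs \<Rightarrow> ('k, 'a, 'a \<Rightarrow> 'k) chu" where
  "T_chu V = (fst V, top_dual V, \<lambda>v \<phi>. \<phi> v)"

definition transpose_map ::
    "('k::real_or_complex, 'a) tvs \<Rightarrow> ('k, 'b) tvs \<Rightarrow> ('a \<Rightarrow> 'b) \<Rightarrow> ('b \<Rightarrow> 'k) \<Rightarrow> 'a \<Rightarrow> 'k" where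
  "transpose_map V W f = (\<lambda>\<phi>\<in>carrier (top_dual W). tvs_comp V \<phi> f)"

definition T_chu_mor ::
    "('k::real_or_complex, 'a) tvs \<Rightarrow> ('k, 'b) tvs \<Rightarrow> ('a \<Rightarrow> 'b) \<Rightarrow>
       ('a \<Rightarrow> 'b) \<times> (('b \<Rightarrow> 'k) \<Rightarrow> 'a \<Rightarrow> 'k)" where
  "T_chu_mor V W f = (f, transpose_map V W f)"

definition R_chu :: "('k::real_or_complex, 'a, 'b) chu \<Rightarrow> ('k, 'a) tvs" where
  "R_chu P = (fst P, sigma_top P)"

definition L_chu :: "('k::real_or_complex, 'a, 'b) chu \<Rightarrow> ('k, 'a) tvs" where
  "L_chu P = (fst P, tau_top P)"

definition R_chu_mor :: "('a \<Rightarrow> 'c) \<times> ('d \<Rightarrow> 'b) \<Rightarrow> 'a \<Rightarrow> 'c" where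
  "R_chu_mor = fst"

definition L_chu_mor :: "('a \<Rightarrow> 'c) \<times> ('d \<Rightarrow> 'b) \<Rightarrow> 'a \<Rightarrow> 'c" where
  "L_chu_mor = fst"

definition TVS_w :: "('k::real_or_complex, 'a) tvs set" where
  "TVS_w = {V \<in> TVS. snd V = sigma_top (T_chu V)}"

definition TVS_m :: "('k::real_or_complex, 'a) tvs set" where
  "TVS_m = {V \<in> TVS. snd V = tau_top (T_chu V)}"

definition D_w :: "('k::real_or_complex, 'a) tvs \<Rightarrow> ('k, 'a \<Rightarrow> 'k) tvs" where
  "D_w V = R_chu (chu_dual (T_chu V))"

definition D_m :: "('k::real_or_complex, 'a) tvs \<Rightarrow> ('k, 'a \<Rightarrow> 'k) tvs" where
  "D_m V = L_chu (chu_dual (T_chu V))"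

definition D_w_mor ::
    "('k::real_or_complex, 'a) tvs \<Rightarrow> ('k, 'b) tvs \<Rightarrow> ('a \<Rightarrow> 'b) \<Rightarrow> ('b \<Rightarrow> 'k) \<Rightarrow> 'a \<Rightarrow> 'k" where
  "D_w_mor V W f = R_chu_mor (chu_dual_mor (T_chu_mor V W f))"

definition D_m_mor ::
    "('k::real_or_complex, 'a) tvs \<Rightarrow> ('k, 'b) tvs \<Rightarrow> ('a \<Rightarrow> 'b) \<Rightarrow> ('b \<Rightarrow> 'k) \<Rightarrow> 'a \<Rightarrow> 'k" where
  "D_m_mor V W f = L_chu_mor (chu_dual_mor (T_chu_mor V W f))"

text \<open>The components of the natural isomorphism from the identity to the double dual. It is a
  constant because a natural family over carriers of all types cannot be
  existentially quantified in HOL.\<close>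

definition double_dual_eval ::
    "('k::real_or_complex, 'a) tvs \<Rightarrow> 'a \<Rightarrow> ('a \<Rightarrow> 'k) \<Rightarrow> 'k" where
  "double_dual_eval V = (\<lambda>v\<in>carrier (fst V). \<lambda>\<phi>\<in>carrier (top_dual V). \<phi> v)"

end

theory Submission
  imports Defs
begin

text \<open>The topology \<open>\<tau>(V, W)\<close> is obtained without the Mackey--Arens theorem on polars: call a
  locally convex topology on \<open>V\<close> compatible if each of its continuous functionals is given by an
  element of \<open>W\<close>. A real-linear functional that is at most 1 on \<open>U \<inter> U'\<close>, with convex
  absorbing \<open>U\<close> and \<open>U'\<close>, is a sum of two functionals that are at most 1 on \<open>U\<close> and on
  \<open>U'\<close>, by Hahn--Banach; so the supremum of compatible topologies is compatible. Hence the
  supremum of all compatible topologies is \<open>\<tau>(V, W)\<close>, and the supremum of the initial topologies of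
  the single functionals is \<open>\<sigma>(V, W)\<close>. The pullback of a compatible topology along a morphism of
  pairs is compatible, again by Hahn--Banach, which gives the functoriality of \<open>\<tau>\<close>. A dual
  topology recovers the pair, so the evaluation map identifies \<open>(V, V')\<close> with \<open>(V'', V')\<close>, and it is a
  homeomorphism because \<open>\<sigma>\<close> and \<open>\<tau>\<close> depend only on the pair.\<close>

section \<open>Real parts of scalars\<close>

text \<open>Neighbourhoods of zero are only known to contain convex sets, which need be neither
  balanced nor symmetric. The arguments therefore use real functionals with the one-sided bound
  \<open>f x \<le> 1\<close>: on a convex neighbourhood such a bound already forces continuity, and
  a scalar-valued functional is recovered from its real part. Domination then is a family of linear
  inequalities, and every use of Hahn--Banach reduces to one question: whether the convex cone
  generated by these inequalities is consistent at zero. The extremal topologies are formed in a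
  larger class than the dual topologies, with no Hausdorff condition and with only an inclusion of
  the dual in the given set of functionals. The initial topology of one functional, or a pullback
  along a map with a kernel, need not separate points and may have too few functionals. Separation
  and the missing functionals return at the end, because the suprema make every functional of the
  pair continuous.\<close>

text \<open>The pair \<open>(r, i)\<close> allows the real and the complex case to be treated together: \<open>i\<close> is 0 if
  the scalars are real and an imaginary unit if they are complex.\<close>

definition real_part_with_unit :: "('k::real_or_complex \<Rightarrow> real) \<Rightarrow> 'k \<Rightarrow> bool" where
  "real_part_with_unit r i \<longleftrightarrow> (\<forall>x y. r (x + y) = r x + r y) \<and> (\<forall>t x. r (of_real t * x) = t * r x) \<and>
     (\<forall>x. \<bar>r x\<bar> \<le> norm x) \<and> r i = 0 \<and> (i = 0 \<or> i * i = -1) \<and>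
     (\<forall>z. of_real (r z) - i * of_real (r (i * z)) = z)"

lemma ex_real_part_with_unit: "\<exists>r (i :: 'k::real_or_complex). real_part_with_unit r i"
  using real_or_complex[where 'a = 'k]
proof
  assume "\<exists>h :: 'k \<Rightarrow> real. bij h \<and> (\<forall>x y. h (x + y) = h x + h y) \<and> (\<forall>x y. h (x * y) = h x * h y) \<and>
        (\<forall>x. norm (h x) = norm x)"
  then obtain h :: "'k \<Rightarrow> real" where bij: "bij h" and add: "\<And>x y. h (x + y) = h x + h y"
    and mult: "\<And>x y. h (x * y) = h x * h y" and nrm: "\<And>x. norm (h x) = norm x" by auto
  have h1: "h 1 = 1" using mult[of 1 1] nrm[of 1] by auto
  have h0: "h 0 = 0" using add[of 0 0] by simp
  have hm: "h (x - y) = h x - h y" for x y using add[of "x - y" y] by simp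
  \<comment> \<open>Linearity over the reals is not among the given properties of \<open>h\<close>.
    The image of a real number is pinned down by its distances to 0 and to 1, which \<open>h\<close>
    preserves.\<close>
  have hr: "h (of_real t) = t" for t
  proof -
    have "\<bar>h (of_real t)\<bar> = \<bar>t\<bar>" using nrm[of "of_real t"] by simp
    moreover have "\<bar>h (of_real t) - 1\<bar> = \<bar>t - 1\<bar>"
      using nrm[of "of_real (t - 1)"] by (simp add: hm h1 del: norm_of_real) (metis norm_of_real of_real_1 of_real_diff)
    ultimately show ?thesis by linarith
  qed
  have inj: "h x = h y \<Longrightarrow> x = y" for x y using bij by (metis bij_is_inj injD)
  have "real_part_with_unit h 0"
    unfolding real_part_with_unit_def
  proof (intro conjI allI)
    show "of_real (h z) - 0 * of_real (h (0 * z)) = z" for z by (rule inj) (simp add: hr)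
    show "\<bar>h x\<bar> \<le> norm x" for x using nrm[of x] by simp
  qed (simp_all add: add mult hr h0)
  then show ?thesis by blast
next
  assume "\<exists>h :: 'k \<Rightarrow> complex. bij h \<and> (\<forall>x y. h (x + y) = h x + h y) \<and> (\<forall>x y. h (x * y) = h x * h y) \<and>
        (\<forall>x. norm (h x) = norm x)"
  then obtain h :: "'k \<Rightarrow> complex" where bij: "bij h" and add: "\<And>x y. h (x + y) = h x + h y"
    and mult: "\<And>x y. h (x * y) = h x * h y" and nrm: "\<And>x. norm (h x) = norm x" by auto
  have h1: "h 1 = 1" using mult[of 1 1] nrm[of 1] by auto
  have h0: "h 0 = 0" using add[of 0 0] by simp
  have hm: "h (x - y) = h x - h y" for x y using add[of "x - y" y] by simp
  \<comment> \<open>The circles about 0 and 1 through the image touch only at \<open>t\<close>: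
    subtracting their equations gives the real part, and then the imaginary part vanishes.\<close>
  have hr: "h (of_real t) = of_real t" for t
  proof -
    have 1: "norm (h (of_real t)) = \<bar>t\<bar>" using nrm[of "of_real t"] by simp
    have 2: "norm (h (of_real t) - 1) = \<bar>t - 1\<bar>"
      using nrm[of "of_real (t - 1)"] by (simp add: hm h1 del: norm_of_real) (metis norm_of_real of_real_1 of_real_diff)
    have 3: "(Re (h (of_real t)))\<^sup>2 + (Im (h (of_real t)))\<^sup>2 = t\<^sup>2"
      using arg_cong[OF 1, of power2] by (simp add: cmod_power2)
    have "(Re (h (of_real t)) - 1)\<^sup>2 + (Im (h (of_real t)))\<^sup>2 = (t - 1)\<^sup>2"
      using arg_cong[OF 2, of power2] by (simp add: cmod_power2)
    with 3 have "Re (h (of_real t)) = t" by (simp add: power2_eq_square algebra_simps)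
    with 3 show ?thesis by (simp add: complex_eq_iff)
  qed
  have inj: "h x = h y \<Longrightarrow> x = y" for x y using bij by (metis bij_is_inj injD)
  obtain i where i: "h i = \<i>" using bij by (metis bij_pointE)
  have "h (- 1) = -1" using hm[of 0 1] h0 h1 by simp
  then have "i * i = - 1" using i by (intro inj) (simp add: mult)
  then have "real_part_with_unit (\<lambda>x. Re (h x)) i"
    unfolding real_part_with_unit_def
  proof (intro conjI allI)
    show "of_real (Re (h z)) - i * of_real (Re (h (i * z))) = z" for z
      by (rule inj) (simp add: add hm mult hr i complex_eq_iff)
    show "\<bar>Re (h x)\<bar> \<le> norm x" for x by (metis abs_Re_le_cmod nrm)
  qed (simp_all add: add mult hr i)
  then show ?thesis by blast
qed

text \<open>One choice of a pair feeds both \<open>re_part\<close> and \<open>im_unit\<close>, so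
  that they satisfy \<open>real_part_with_unit\<close> together.\<close>

definition re_part :: "'k::real_or_complex \<Rightarrow> real" where
  "re_part = fst (SOME q. real_part_with_unit (fst q) (snd q))"

definition im_unit :: "'k::real_or_complex" where
  "im_unit = snd (SOME q. real_part_with_unit (fst q) (snd q))"

lemma real_part_with_unit: "real_part_with_unit re_part (im_unit :: 'a::real_or_complex)"
  unfolding re_part_def im_unit_def
  by (rule someI_ex[of "\<lambda>q. real_part_with_unit (fst q) (snd q)"]) (use ex_real_part_with_unit in auto)

lemma
  fixes x y z :: "'a::real_or_complex"
  shows re_part_add: "re_part (x + y) = re_part x + re_part y"
  and re_part_of_real_mult: "re_part (of_real t * x) = t * re_part x"
  and re_part_le_norm: "\<bar>re_part x\<bar> \<le> norm x"
  and re_part_im_unit: "re_part (im_unit :: 'a) = 0"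
  and im_unit_cases: "im_unit = (0 :: 'a) \<or> im_unit * im_unit = (- 1 :: 'a)"
  and scalar_decomp: "of_real (re_part z) - im_unit * of_real (re_part (im_unit * z)) = z"
  using real_part_with_unit[where 'a = 'a] unfolding real_part_with_unit_def by fast+

lemma re_part_zero [simp]: "re_part 0 = 0"
  using re_part_le_norm[of 0] by simp

lemma re_part_minus: "re_part (- x) = - re_part x"
  using re_part_of_real_mult[of "-1" x] by simp

lemma re_part_diff: "re_part (x - y) = re_part x - re_part y"
  using re_part_add[of x "- y"] by (simp add: re_part_minus)

lemma re_part_one [simp]: "re_part (1 :: 'k::real_or_complex) = 1"
proof -
  have "of_real (re_part (1 :: 'k)) = (1 :: 'k)"
    using scalar_decomp[of "1 :: 'k"] by (simp add: re_part_im_unit)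
  then show ?thesis by (simp only: of_real_eq_1_iff)
qed

lemma re_part_of_real [simp]: "re_part (of_real t) = t"
  using re_part_of_real_mult[of t 1] by simp

lemma continuous_on_re_part: "continuous_on UNIV (re_part :: 'k::real_or_complex \<Rightarrow> real)"
proof (rule continuous_onI)
  fix x :: 'k and e assume "(e::real) > 0"
  then show "\<exists>d>0. \<forall>x'\<in>UNIV. dist x' x < d \<longrightarrow> dist (re_part x') (re_part x) \<le> e"
    by (intro exI[of _ e])
      (metis dist_norm dist_real_def less_imp_le order_trans re_part_diff re_part_le_norm)
qed

section \<open>Hahn--Banach for cones of constraints\<close>

text \<open>Hahn--Banach involves real scalars only; \<open>kspace\<close> enters through
  \<open>of_real\<close>, so real and complex spaces share one proof.\<close>

locale real_space =
  fixes C :: "'a set" and add :: "'a \<Rightarrow> 'a \<Rightarrow> 'a" (infixl "\<boxplus>" 65) and zr :: 'a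
    and scl :: "real \<Rightarrow> 'a \<Rightarrow> 'a" (infixr "\<star>" 75)
  assumes add_closed [simp, intro]: "x \<in> C \<Longrightarrow> y \<in> C \<Longrightarrow> x \<boxplus> y \<in> C"
    and zr_closed [simp, intro]: "zr \<in> C"
    and scl_closed [simp, intro]: "x \<in> C \<Longrightarrow> t \<star> x \<in> C"
    and add_commute: "x \<in> C \<Longrightarrow> y \<in> C \<Longrightarrow> x \<boxplus> y = y \<boxplus> x"
    and add_assoc: "x \<in> C \<Longrightarrow> y \<in> C \<Longrightarrow> u \<in> C \<Longrightarrow> x \<boxplus> y \<boxplus> u = x \<boxplus> (y \<boxplus> u)"
    and add_zr [simp]: "x \<in> C \<Longrightarrow> x \<boxplus> zr = x"
    and scl_add_left: "x \<in> C \<Longrightarrow> (s + t) \<star> x = s \<star> x \<boxplus> t \<star> x"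
    and scl_add_right: "x \<in> C \<Longrightarrow> y \<in> C \<Longrightarrow> t \<star> (x \<boxplus> y) = t \<star> x \<boxplus> t \<star> y"
    and scl_scl [simp]: "x \<in> C \<Longrightarrow> s \<star> (t \<star> x) = (s * t) \<star> x"
    and scl_one [simp]: "x \<in> C \<Longrightarrow> 1 \<star> x = x"
    and scl_zero [simp]: "x \<in> C \<Longrightarrow> 0 \<star> x = zr"
begin

lemma zr_add [simp]: "x \<in> C \<Longrightarrow> zr \<boxplus> x = x"
  using add_commute[of zr x] by simp

lemma add_left_commute: "x \<in> C \<Longrightarrow> y \<in> C \<Longrightarrow> u \<in> C \<Longrightarrow> x \<boxplus> (y \<boxplus> u) = y \<boxplus> (x \<boxplus> u)"
  by (metis add_assoc add_commute)

lemmas add_ac = add_assoc add_commute add_left_commute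

lemma scl_zr [simp]: "t \<star> zr = zr"
  using scl_scl[of zr t 0] by simp

lemma add_neg: "x \<in> C \<Longrightarrow> t \<star> x \<boxplus> (- t) \<star> x = zr"
  by (simp flip: scl_add_left)

lemma add_eq_zr: "x \<in> C \<Longrightarrow> y \<in> C \<Longrightarrow> x \<boxplus> y = zr \<Longrightarrow> x = (-1) \<star> y"
  by (metis add_assoc add_commute add_neg add_zr scl_closed scl_one)

definition real_linear :: "('a \<Rightarrow> real) \<Rightarrow> bool" where
  "real_linear f \<longleftrightarrow> (\<forall>x\<in>C. \<forall>y\<in>C. f (x \<boxplus> y) = f x + f y) \<and> (\<forall>t. \<forall>x\<in>C. f (t \<star> x) = t * f x)"

lemma real_linearD:
  assumes "real_linear f"
  shows "x \<in> C \<Longrightarrow> y \<in> C \<Longrightarrow> f (x \<boxplus> y) = f x + f y" "x \<in> C \<Longrightarrow> f (t \<star> x) = t * f x"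
  using assms by (auto simp: real_linear_def)

text \<open>An element \<open>(x, r)\<close> of the cone stands for the constraint \<open>f x \<le> r\<close> on a functional \<open>f\<close>.\<close>

definition total_cone :: "('a \<times> real) set \<Rightarrow> bool" where
  "total_cone K \<longleftrightarrow> K \<subseteq> C \<times> UNIV \<and>
     (\<forall>x r y s. (x, r) \<in> K \<longrightarrow> (y, s) \<in> K \<longrightarrow> (x \<boxplus> y, r + s) \<in> K) \<and>
     (\<forall>x r t. (x, r) \<in> K \<longrightarrow> t > 0 \<longrightarrow> (t \<star> x, t * r) \<in> K) \<and>
     (\<forall>x\<in>C. \<exists>r. (x, r) \<in> K) \<and> (\<forall>c. (zr, c) \<in> K \<longrightarrow> 0 \<le> c)"

lemma total_coneI:
  assumes "\<And>x r. (x, r) \<in> K \<Longrightarrow> x \<in> C"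
    "\<And>x r y s. (x, r) \<in> K \<Longrightarrow> (y, s) \<in> K \<Longrightarrow> (x \<boxplus> y, r + s) \<in> K"
    "\<And>x r t. (x, r) \<in> K \<Longrightarrow> t > 0 \<Longrightarrow> (t \<star> x, t * r) \<in> K"
    "\<And>x. x \<in> C \<Longrightarrow> \<exists>r. (x, r) \<in> K" "\<And>c. (zr, c) \<in> K \<Longrightarrow> 0 \<le> c"
  shows "total_cone K"
  using assms unfolding total_cone_def by auto

text \<open>Let \<open>f x\<close> be the least bound that a maximal cone imposes at \<open>x\<close>; it is sublinear. The
  constraint \<open>(y, - f (- y))\<close> can be added consistently, so maximality gives \<open>f y \<le> - f (- y)\<close> and
  \<open>f\<close> is linear.\<close>

lemma hahn_banach_cone:
  assumes K: "total_cone K"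
  obtains f where "real_linear f" "\<And>x r. (x, r) \<in> K \<Longrightarrow> f x \<le> r"
proof -
  have "\<exists>M\<in>{M. total_cone M \<and> K \<subseteq> M}. \<forall>N\<in>{M. total_cone M \<and> K \<subseteq> M}. M \<subseteq> N \<longrightarrow> N = M"
  proof (rule subset_Zorn_nonempty)
    show "{M. total_cone M \<and> K \<subseteq> M} \<noteq> {}" using K by auto
    fix \<C> assume ne: "\<C> \<noteq> {}" and ch: "subset.chain {M. total_cone M \<and> K \<subseteq> M} \<C>"
    then have sub: "\<And>N. N \<in> \<C> \<Longrightarrow> total_cone N \<and> K \<subseteq> N"
      and lin: "\<And>N N'. N \<in> \<C> \<Longrightarrow> N' \<in> \<C> \<Longrightarrow> N \<subseteq> N' \<or> N' \<subseteq> N"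
      by (auto simp: subset_chain_def)
    have "total_cone (\<Union>\<C>)"
    proof (rule total_coneI)
      show "x \<in> C" if "(x, r) \<in> \<Union>\<C>" for x r
        using that sub unfolding total_cone_def by blast
      show "(x \<boxplus> y, r + s) \<in> \<Union>\<C>" if xr: "(x, r) \<in> \<Union>\<C>" "(y, s) \<in> \<Union>\<C>" for x r y s
      proof -
        from xr obtain N N' where "N \<in> \<C>" "N' \<in> \<C>" "(x, r) \<in> N" "(y, s) \<in> N'" by auto
        then obtain L where "L \<in> \<C>" "(x, r) \<in> L" "(y, s) \<in> L" using lin by blast
        then show ?thesis using sub[of L] unfolding total_cone_def by blast
      qed
      show "(t \<star> x, t * r) \<in> \<Union>\<C>" if "(x, r) \<in> \<Union>\<C>" "t > 0" for x r t
        using that sub unfolding total_cone_def by blast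
      show "\<exists>r. (x, r) \<in> \<Union>\<C>" if "x \<in> C" for x
        using that sub ne unfolding total_cone_def by blast
      show "0 \<le> c" if "(zr, c) \<in> \<Union>\<C>" for c
        using that sub unfolding total_cone_def by blast
    qed
    then show "\<Union>\<C> \<in> {M. total_cone M \<and> K \<subseteq> M}" using ne sub by blast
  qed
  then obtain M where M: "total_cone M" and KM: "K \<subseteq> M"
    and maxM: "\<And>N. total_cone N \<Longrightarrow> M \<subseteq> N \<Longrightarrow> N = M" by (auto 4 4)
  have MC: "\<And>x r. (x, r) \<in> M \<Longrightarrow> x \<in> C"
    and Madd: "\<And>x r y s. (x, r) \<in> M \<Longrightarrow> (y, s) \<in> M \<Longrightarrow> (x \<boxplus> y, r + s) \<in> M"
    and Mscl: "\<And>x r t. (x, r) \<in> M \<Longrightarrow> t > 0 \<Longrightarrow> (t \<star> x, t * r) \<in> M"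
    and Mtot: "\<And>x. x \<in> C \<Longrightarrow> \<exists>r. (x, r) \<in> M" and M0: "\<And>c. (zr, c) \<in> M \<Longrightarrow> 0 \<le> c"
    using M unfolding total_cone_def by blast+
  define f where "f x = Inf {r. (x, r) \<in> M}" for x
  \<comment> \<open>A constraint \<open>(- x, s)\<close> of \<open>M\<close> gives the lower bound:
    added to \<open>(x, r)\<close> it yields \<open>(zr, r + s)\<close>, and consistency forces
    \<open>- s \<le> r\<close>.\<close>
  have bdd: "bdd_below {r. (x, r) \<in> M}" if x: "x \<in> C" for x
  proof -
    obtain s where s: "((-1) \<star> x, s) \<in> M" using Mtot x by blast
    have "- s \<le> r" if "(x, r) \<in> M" for r
      using M0[of "r + s"] Madd[OF that s] add_neg[OF x, of 1] x by simp
    then show ?thesis by (intro bdd_belowI[of _ "- s"]) simp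
  qed
  have f_le: "f x \<le> r" if "(x, r) \<in> M" for x r
    unfolding f_def using that MC by (intro cInf_lower bdd) auto
  have le_f: "b \<le> f x" if "x \<in> C" "\<And>r. (x, r) \<in> M \<Longrightarrow> b \<le> r" for x b
    unfolding f_def using that Mtot by (intro cInf_greatest) auto
  have eps: "\<exists>r. (x, r) \<in> M \<and> r < f x + e" if "x \<in> C" "e > 0" for x e
    using le_f[OF that(1), of "f x + e"] that(2) by force
  have f_sub: "f (x \<boxplus> y) \<le> f x + f y" if xy: "x \<in> C" "y \<in> C" for x y
  proof (rule field_le_epsilon)
    fix e :: real assume "e > 0"
    then obtain r s where "(x, r) \<in> M" "r < f x + e/2" "(y, s) \<in> M" "s < f y + e/2"
      using eps[of x "e/2"] eps[of y "e/2"] xy by auto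
    then show "f (x \<boxplus> y) \<le> f x + f y + e" using f_le[OF Madd, of x r y s] by linarith
  qed
  have f_scl_le: "f (t \<star> x) \<le> t * f x" if x: "x \<in> C" and t: "t > 0" for x t
  proof (rule field_le_epsilon)
    fix e :: real assume "e > 0"
    then obtain r where r: "(x, r) \<in> M" "r < f x + e/t" using eps[of x "e/t"] x t by auto
    have "t * r < t * (f x + e/t)" using r(2) t by (rule mult_strict_left_mono)
    also have "\<dots> = t * f x + e" using t by (simp add: distrib_left)
    finally have "t * r < t * f x + e" .
    then show "f (t \<star> x) \<le> t * f x + e" using f_le[OF Mscl[OF r(1) t]] by simp
  qed
  \<comment> \<open>The inequality for the factor \<open>1/t\<close> is the converse of the one for
    \<open>t\<close>.\<close>
  have f_scl: "f (t \<star> x) = t * f x" if x: "x \<in> C" and t: "t > 0" for x t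
  proof (rule antisym[OF f_scl_le[OF x t]])
    have "f x \<le> (1/t) * f (t \<star> x)" using f_scl_le[of "t \<star> x" "1/t"] x t by simp
    then show "t * f x \<le> f (t \<star> x)" using t by (simp add: field_simps)
  qed
  have f0: "f zr = 0" using f_scl[of zr 2] by simp
  have f_odd_le: "f y \<le> - f ((-1) \<star> y)" if y: "y \<in> C" for y
  proof -
    \<comment> \<open>The smallest bound at \<open>y\<close> consistent with \<open>M\<close>: every
      bound \<open>a\<close> at \<open>- y\<close> requires \<open>a + s \<ge> 0\<close>, and
      \<open>f (- y)\<close> is the infimum of these \<open>a\<close>.\<close>
    define s where "s = - f ((-1) \<star> y)"
    \<comment> \<open>The cone generated by \<open>M\<close> and \<open>(y, s)\<close>; the value
      \<open>t = 0\<close> is allowed so that \<open>M\<close> is contained in it.\<close>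
    define N where "N = {(x \<boxplus> t \<star> y, r + t * s) | x r t. (x, r) \<in> M \<and> t \<ge> 0}"
    have NI: "(u \<boxplus> t \<star> y, a + t * s) \<in> N" if "(u, a) \<in> M" "t \<ge> 0" for u a t
      using that unfolding N_def by blast
    have N: "total_cone N"
    proof (rule total_coneI)
      show "x \<in> C" if "(x, r) \<in> N" for x r using that MC y by (auto simp: N_def)
      show "(x \<boxplus> x', r + r') \<in> N" if "(x, r) \<in> N" "(x', r') \<in> N" for x r x' r'
      proof -
        from that obtain u a t u' a' t' where *: "x = u \<boxplus> t \<star> y" "r = a + t * s" "(u, a) \<in> M" "t \<ge> 0"
          "x' = u' \<boxplus> t' \<star> y" "r' = a' + t' * s" "(u', a') \<in> M" "t' \<ge> 0"
          by (auto simp: N_def)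
        have "x \<boxplus> x' = (u \<boxplus> u') \<boxplus> (t + t') \<star> y"
          using * MC y by (simp add: scl_add_left add_ac)
        moreover have "r + r' = (a + a') + (t + t') * s" using * by (simp add: algebra_simps)
        ultimately show ?thesis using NI[OF Madd[OF *(3,7)], of "t + t'"] *(4,8) by simp
      qed
      show "(k \<star> x, k * r) \<in> N" if "(x, r) \<in> N" "k > 0" for x r k
      proof -
        from that obtain u a t where *: "x = u \<boxplus> t \<star> y" "r = a + t * s" "(u, a) \<in> M" "t \<ge> 0"
          by (auto simp: N_def)
        then have "k \<star> x = k \<star> u \<boxplus> (k * t) \<star> y" "k * r = k * a + (k * t) * s"
          using MC y by (simp_all add: scl_add_right algebra_simps)
        then show ?thesis using NI[OF Mscl[OF *(3) that(2)], of "k * t"] *(4) that(2) by simp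
      qed
      show "\<exists>r. (x, r) \<in> N" if "x \<in> C" for x
      proof -
        obtain r where "(x, r) \<in> M" using Mtot \<open>x \<in> C\<close> by blast
        then have "(x \<boxplus> 0 \<star> y, r + 0 * s) \<in> N" unfolding N_def by blast
        then show ?thesis using \<open>x \<in> C\<close> y by auto
      qed
      show "0 \<le> c" if "(zr, c) \<in> N" for c
      proof -
        from that obtain u a t where *: "zr = u \<boxplus> t \<star> y" "c = a + t * s" "(u, a) \<in> M" "t \<ge> 0"
          by (auto simp: N_def)
        then have u: "u = (- t) \<star> y" using add_eq_zr[of u "t \<star> y"] MC y by simp
        show ?thesis
        proof (cases "t = 0")
          case True then show ?thesis using * u y M0 by simp
        next
          case False
          then have t: "t > 0" using * by simp
          \<comment> \<open>Division by \<open>t\<close> turns \<open>u\<close> into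
            \<open>- y\<close>, so \<open>a/t\<close> is a bound of \<open>M\<close> at
            \<open>- y\<close>; this is the case for which \<open>s\<close> was chosen.\<close>
          have "(1/t) \<star> u = (-1) \<star> y" using u y t by simp
          then have "f ((-1) \<star> y) \<le> (1/t) * a" using f_le[OF Mscl[OF *(3), of "1/t"]] t by simp
          then show ?thesis using t by (simp add: *(2) s_def field_simps)
        qed
      qed
    qed
    have "M \<subseteq> N"
    proof (rule subrelI)
      fix x r assume xr: "(x, r) \<in> M"
      then have "(x \<boxplus> 0 \<star> y, r + 0 * s) \<in> N" unfolding N_def by blast
      then show "(x, r) \<in> N" using MC[OF xr] y by simp
    qed
    then have NM: "N = M" using maxM N by blast
    \<comment> \<open>The infimum \<open>f zr = 0\<close> need not be attained in \<open>M\<close>,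
      so \<open>(y, s)\<close> itself may be missing from \<open>N\<close>; with an error below
      \<open>e\<close> a constraint at \<open>y\<close> is present.\<close>
    show ?thesis
    proof (rule field_le_epsilon)
      fix e :: real assume "e > 0"
      then obtain r where r: "(zr, r) \<in> M" "r < e" using eps[of zr e] f0 by auto
      then have "(zr \<boxplus> 1 \<star> y, r + 1 * s) \<in> N" unfolding N_def by (blast intro: zero_le_one)
      then show "f y \<le> - f ((-1) \<star> y) + e" using f_le[of y "r + s"] r(2) y NM by (simp add: s_def)
    qed
  qed
  have f_odd: "f ((-1) \<star> y) = - f y" if y: "y \<in> C" for y
    using f_odd_le[OF y] f_sub[of y "(-1) \<star> y"] y add_neg[OF y, of 1] f0 by simp
  have "real_linear f" unfolding real_linear_def
  proof (intro conjI ballI allI)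
    fix x y assume xy: "x \<in> C" "y \<in> C"
    have "x = (x \<boxplus> y) \<boxplus> (-1) \<star> y" using xy add_neg[of y 1] by (simp add: add_assoc)
    then have "f x \<le> f (x \<boxplus> y) - f y" using f_sub[of "x \<boxplus> y" "(-1) \<star> y"] xy f_odd by simp
    then show "f (x \<boxplus> y) = f x + f y" using f_sub[OF xy] by linarith
  next
    fix t :: real and x assume x: "x \<in> C"
    consider "t > 0" | "t = 0" | "t < 0" by linarith
    then show "f (t \<star> x) = t * f x"
    proof cases
      case 3
      then have "t \<star> x = (- t) \<star> ((-1) \<star> x)" using x by simp
      then show ?thesis using f_scl[of "(-1) \<star> x" "- t"] f_odd x 3 by simp
    qed (use f_scl x f0 in auto)
  qed
  with f_le KM show ?thesis using that by blast
qed

end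

section \<open>Splitting and extending functionals dominated on convex absorbing sets\<close>

context real_space begin

definition convex_subset :: "'a set \<Rightarrow> bool" where
  "convex_subset U \<longleftrightarrow> U \<subseteq> C \<and>
     (\<forall>x\<in>U. \<forall>y\<in>U. \<forall>t. 0 \<le> t \<and> t \<le> 1 \<longrightarrow> t \<star> x \<boxplus> (1 - t) \<star> y \<in> U)"

definition absorbing :: "'a set \<Rightarrow> bool" where
  "absorbing U \<longleftrightarrow> (\<forall>x\<in>C. \<exists>e>0. \<forall>t. 0 < t \<and> t \<le> e \<longrightarrow> t \<star> x \<in> U)"

lemma absorbing_zr: "absorbing U \<Longrightarrow> zr \<in> U"
  unfolding absorbing_def by (metis order_refl scl_zr zr_closed)

lemma convex_subset_scl:
  assumes "convex_subset U" "zr \<in> U" "u \<in> U" "0 \<le> t" "t \<le> 1"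
  shows "t \<star> u \<in> U"
proof -
  have "t \<star> u \<boxplus> (1 - t) \<star> zr \<in> U" using assms unfolding convex_subset_def by blast
  moreover have "u \<in> C" using assms by (auto simp: convex_subset_def)
  ultimately show ?thesis by simp
qed

text \<open>Convexity after normalising the weights to sum 1. It keeps the cones built from
  \<open>U\<close> closed under addition.\<close>

lemma convex_subset_combine:
  assumes U: "convex_subset U" and uv: "u \<in> U" "v \<in> U" and ab: "a > 0" "b > 0"
  obtains w where "w \<in> U" "a \<star> u \<boxplus> b \<star> v = (a + b) \<star> w"
proof -
  have C: "u \<in> C" "v \<in> C" using U uv by (auto simp: convex_subset_def)
  have t: "0 \<le> a/(a+b)" "a/(a+b) \<le> 1" using ab by (auto simp: field_simps)
  have *: "(a + b) * (a/(a+b)) = a" "(a + b) * (1 - a/(a+b)) = b" using ab by (auto simp: field_simps)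
  let ?w = "(a/(a+b)) \<star> u \<boxplus> (1 - a/(a+b)) \<star> v"
  have "?w \<in> U" using U uv t unfolding convex_subset_def by blast
  moreover have "(a + b) \<star> ?w = a \<star> u \<boxplus> b \<star> v"
    using C by (simp only: scl_add_right scl_closed scl_scl *)
  ultimately show ?thesis using that by metis
qed

text \<open>The constraints \<open>g \<le> 1\<close> on \<open>U\<close> and
  \<open>f - g \<le> 1\<close> on \<open>W\<close> can clash only where a positive multiple of a
  point of \<open>U\<close> equals one of a point of \<open>W\<close>; the bound of \<open>f\<close>
  on the intersection excludes a contradiction there.\<close>

lemma dominated_sum_decomposition:
  assumes U: "convex_subset U" "absorbing U" and W: "convex_subset W" "absorbing W"
    and f: "real_linear f" and f1: "\<And>x. x \<in> U \<Longrightarrow> x \<in> W \<Longrightarrow> f x \<le> 1"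
  obtains g where "real_linear g" "\<And>x. x \<in> U \<Longrightarrow> g x \<le> 1" "\<And>x. x \<in> W \<Longrightarrow> f x - g x \<le> 1"
proof -
  have z: "zr \<in> U" "zr \<in> W" using U W absorbing_zr by auto
  have UC: "\<And>x. x \<in> U \<Longrightarrow> x \<in> C" and WC: "\<And>x. x \<in> W \<Longrightarrow> x \<in> C"
    using U W by (auto simp: convex_subset_def)
  have f0: "f zr = 0" using real_linearD(2)[OF f, of zr 0] by simp
  \<comment> \<open>Positive combinations of the constraints \<open>(u, 1)\<close> and
    \<open>(- w, 1 - f w)\<close>; the latter is \<open>f w - g w \<le> 1\<close> rewritten for
    \<open>g\<close>.\<close>
  define K where "K = {(a \<star> u \<boxplus> (- b) \<star> w, a + b - b * f w) | a u b w. a > 0 \<and> u \<in> U \<and> b > 0 \<and> w \<in> W}"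
  have KI: "(a \<star> u \<boxplus> (- b) \<star> w, a + b - b * f w) \<in> K" if "a > 0" "u \<in> U" "b > 0" "w \<in> W" for a u b w
    using that unfolding K_def by blast
  have KE: "\<exists>a u b w. a > 0 \<and> u \<in> U \<and> b > 0 \<and> w \<in> W \<and> x = a \<star> u \<boxplus> (- b) \<star> w \<and> r = a + b - b * f w"
    if "(x, r) \<in> K" for x r
    using that unfolding K_def by blast
  have "total_cone K"
  proof (rule total_coneI)
    show "x \<in> C" if "(x, r) \<in> K" for x r using KE[OF that] UC WC by auto
    show "(x \<boxplus> y, r + s) \<in> K" if xy: "(x, r) \<in> K" "(y, s) \<in> K" for x r y s
    proof -
      from KE[OF xy(1)] obtain a u b w where 1: "a > 0" "u \<in> U" "b > 0" "w \<in> W"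
        "x = a \<star> u \<boxplus> (- b) \<star> w" "r = a + b - b * f w" by blast
      from KE[OF xy(2)] obtain a' u' b' w' where 2: "a' > 0" "u' \<in> U" "b' > 0" "w' \<in> W"
        "y = a' \<star> u' \<boxplus> (- b') \<star> w'" "s = a' + b' - b' * f w'" by blast
      obtain p where p: "p \<in> U" "a \<star> u \<boxplus> a' \<star> u' = (a + a') \<star> p"
        using convex_subset_combine[OF U(1) 1(2) 2(2) 1(1) 2(1)] by blast
      obtain q where q: "q \<in> W" "b \<star> w \<boxplus> b' \<star> w' = (b + b') \<star> q"
        using convex_subset_combine[OF W(1) 1(4) 2(4) 1(3) 2(3)] by blast
      have C: "u \<in> C" "u' \<in> C" "w \<in> C" "w' \<in> C" "q \<in> C" "p \<in> C" using 1 2 p q UC WC by auto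
      have "(b + b') * f q = b * f w + b' * f w'"
        using arg_cong[OF q(2), of f] C by (simp add: real_linearD[OF f])
      then have rs: "r + s = (a + a') + (b + b') - (b + b') * f q"
        using 1 2 by simp
      have "(- b) \<star> w \<boxplus> (- b') \<star> w' = (- (b + b')) \<star> q"
        using arg_cong[OF q(2), of "\<lambda>x. (-1) \<star> x"] C by (simp add: scl_add_right)
      moreover have "x \<boxplus> y = (a \<star> u \<boxplus> a' \<star> u') \<boxplus> ((- b) \<star> w \<boxplus> (- b') \<star> w')"
        using 1 2 C by (simp add: add_ac)
      ultimately have "x \<boxplus> y = (a + a') \<star> p \<boxplus> (- (b + b')) \<star> q" using p by simp
      moreover have "((a + a') \<star> p \<boxplus> (- (b + b')) \<star> q, (a + a') + (b + b') - (b + b') * f q) \<in> K"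
        using 1 2 p q by (intro KI) auto
      ultimately show ?thesis by (simp only: rs)
    qed
    show "(t \<star> x, t * r) \<in> K" if xr: "(x, r) \<in> K" "t > 0" for x r t
    proof -
      from KE[OF xr(1)] obtain a u b w where 1: "a > 0" "u \<in> U" "b > 0" "w \<in> W"
        "x = a \<star> u \<boxplus> (- b) \<star> w" "r = a + b - b * f w" by blast
      have "t \<star> x = (t * a) \<star> u \<boxplus> (- (t * b)) \<star> w"
        using 1 UC WC by (simp add: scl_add_right)
      moreover have "t * r = t * a + t * b - t * b * f w"
        unfolding 1(6) by (simp add: algebra_simps)
      ultimately show ?thesis using KI[of "t * a" u "t * b" w] 1 xr(2) by simp
    qed
    show "\<exists>r. (x, r) \<in> K" if x: "x \<in> C" for x
    proof -
      obtain e where e: "e > 0" "e \<star> x \<in> U" using U(2) x unfolding absorbing_def by (metis order_refl)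
      then show ?thesis using KI[of "1/e" "e \<star> x" 1 zr] z x by auto
    qed
    show "0 \<le> c" if zc: "(zr, c) \<in> K" for c
    proof -
      from KE[OF zc] obtain a u b w where 1: "a > 0" "u \<in> U" "b > 0" "w \<in> W"
        "zr = a \<star> u \<boxplus> (- b) \<star> w" "c = a + b - b * f w" by blast
      \<comment> \<open>Divided by the larger weight, the common point
        \<open>a \<star> u = b \<star> w\<close> lies in both \<open>U\<close> and \<open>W\<close>,
        as each is convex and contains zero; hence
        \<open>b * f w \<le> m \<le> a + b\<close>.\<close>
      define m where "m = max a b"
      have m: "m > 0" "0 \<le> a/m" "a/m \<le> 1" "0 \<le> b/m" "b/m \<le> 1" using 1 by (auto simp: m_def)
      have "a \<star> u = b \<star> w" using add_eq_zr[of "a \<star> u" "(- b) \<star> w"] 1 UC WC by simp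
      then have "(1/m) \<star> (a \<star> u) = (1/m) \<star> (b \<star> w)" by (rule arg_cong)
      then have "(a/m) \<star> u = (b/m) \<star> w" using UC[OF 1(2)] WC[OF 1(4)] by simp
      then have "f ((b/m) \<star> w) \<le> 1"
        using convex_subset_scl[OF U(1) z(1) 1(2) m(2,3)] convex_subset_scl[OF W(1) z(2) 1(4) m(4,5)]
        by (intro f1) simp_all
      then have "b * f w \<le> m" using m(1) 1 WC by (simp add: real_linearD[OF f] field_simps)
      then show ?thesis using 1 by (simp add: m_def)
    qed
  qed
  then obtain g where g: "real_linear g" and gK: "\<And>x r. (x, r) \<in> K \<Longrightarrow> g x \<le> r"
    using hahn_banach_cone by blast
  \<comment> \<open>Both weights in \<open>K\<close> are strictly positive, so a single constraint
    is reached only up to \<open>e\<close>: the other set contributes zero with weight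
    \<open>e\<close>.\<close>
  have "g x \<le> 1" if x: "x \<in> U" for x
  proof (rule field_le_epsilon)
    fix e :: real assume "e > 0"
    then show "g x \<le> 1 + e" using gK[OF KI[of 1 x e zr]] x z UC f0 by simp
  qed
  moreover have "f x - g x \<le> 1" if x: "x \<in> W" for x
  proof (rule field_le_epsilon)
    fix e :: real assume "e > 0"
    then show "f x - g x \<le> 1 + e"
      using gK[OF KI[of e zr 1 x]] x z WC by (simp add: real_linearD(2)[OF g])
  qed
  ultimately show ?thesis using that g by blast
qed

text \<open>\<open>G\<close> is the graph of a functional on a subspace; that it is single-valued follows from the bound
  on \<open>U\<close>.\<close>

lemma dominated_extension:
  assumes U: "convex_subset U" "absorbing U"
    and G: "G \<subseteq> C \<times> UNIV" "(zr, 0) \<in> G"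
      "\<And>x r y s. (x, r) \<in> G \<Longrightarrow> (y, s) \<in> G \<Longrightarrow> (x \<boxplus> y, r + s) \<in> G"
      "\<And>x r t. (x, r) \<in> G \<Longrightarrow> (t \<star> x, t * r) \<in> G"
    and GU: "\<And>x r. (x, r) \<in> G \<Longrightarrow> x \<in> U \<Longrightarrow> r \<le> 1"
  obtains f where "real_linear f" "\<And>x. x \<in> U \<Longrightarrow> f x \<le> 1" "\<And>x r. (x, r) \<in> G \<Longrightarrow> f x = r"
proof -
  have z: "zr \<in> U" using U absorbing_zr by auto
  have UC: "\<And>x. x \<in> U \<Longrightarrow> x \<in> C" and GC: "\<And>x r. (x, r) \<in> G \<Longrightarrow> x \<in> C"
    using U G(1) by (auto simp: convex_subset_def)
  \<comment> \<open>The graph enters as inequalities \<open>f x \<le> r\<close>. They become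
    equations at the end because \<open>G\<close> also contains \<open>(- x, - r)\<close>.\<close>
  define K where "K = {(a \<star> u \<boxplus> x, a + r) | a u x r. a > 0 \<and> u \<in> U \<and> (x, r) \<in> G}"
  have KI: "(a \<star> u \<boxplus> x, a + r) \<in> K" if "a > 0" "u \<in> U" "(x, r) \<in> G" for a u x r
    using that unfolding K_def by blast
  have KE: "\<exists>a u x r. a > 0 \<and> u \<in> U \<and> (x, r) \<in> G \<and> y = a \<star> u \<boxplus> x \<and> s = a + r"
    if "(y, s) \<in> K" for y s
    using that unfolding K_def by blast
  have "total_cone K"
  proof (rule total_coneI)
    show "x \<in> C" if "(x, r) \<in> K" for x r using KE[OF that] UC GC by blast
    show "(y \<boxplus> y', s + s') \<in> K" if xy: "(y, s) \<in> K" "(y', s') \<in> K" for y s y' s'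
    proof -
      from KE[OF xy(1)] obtain a u x r where 1: "a > 0" "u \<in> U" "(x, r) \<in> G"
        "y = a \<star> u \<boxplus> x" "s = a + r" by blast
      from KE[OF xy(2)] obtain a' u' x' r' where 2: "a' > 0" "u' \<in> U" "(x', r') \<in> G"
        "y' = a' \<star> u' \<boxplus> x'" "s' = a' + r'" by blast
      obtain p where p: "p \<in> U" "a \<star> u \<boxplus> a' \<star> u' = (a + a') \<star> p"
        using convex_subset_combine[OF U(1) 1(2) 2(2) 1(1) 2(1)] by blast
      have C: "u \<in> C" "u' \<in> C" "x \<in> C" "x' \<in> C" using 1 2 UC GC by auto
      have "y \<boxplus> y' = (a \<star> u \<boxplus> a' \<star> u') \<boxplus> (x \<boxplus> x')" using 1 2 C by (simp add: add_ac)
      with KI[OF _ p(1) G(3)[OF 1(3) 2(3)], of "a + a'"] 1 2 p show ?thesis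
        by (simp add: algebra_simps)
    qed
    show "(t \<star> y, t * s) \<in> K" if xr: "(y, s) \<in> K" "t > 0" for y s t
    proof -
      from KE[OF xr(1)] obtain a u x r where 1: "a > 0" "u \<in> U" "(x, r) \<in> G"
        "y = a \<star> u \<boxplus> x" "s = a + r" by blast
      then have "t \<star> y = (t * a) \<star> u \<boxplus> t \<star> x" "t * s = t * a + t * r"
        using UC GC by (simp_all add: scl_add_right algebra_simps)
      then show ?thesis using KI[OF _ 1(2) G(4)[OF 1(3)], of "t * a" t] 1 xr(2) by simp
    qed
    show "\<exists>r. (x, r) \<in> K" if x: "x \<in> C" for x
    proof -
      obtain e where e: "e > 0" "e \<star> x \<in> U" using U(2) x unfolding absorbing_def by (metis order_refl)
      then show ?thesis using KI[of "1/e" "e \<star> x" zr 0] G(2) x by auto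
    qed
    show "0 \<le> c" if zc: "(zr, c) \<in> K" for c
    proof -
      from KE[OF zc] obtain a u x r where 1: "a > 0" "u \<in> U" "(x, r) \<in> G"
        "zr = a \<star> u \<boxplus> x" "c = a + r" by blast
      \<comment> \<open>Cancellation to zero puts the multiple of \<open>x\<close> by
        \<open>- 1/a\<close> into \<open>U\<close>, where \<open>GU\<close> bounds the graph value
        \<open>- r/a\<close> by 1.\<close>
      have "a \<star> u = (-1) \<star> x" using add_eq_zr[of "a \<star> u" x] 1 UC GC by simp
      then have "(1/a) \<star> (a \<star> u) = (1/a) \<star> ((-1) \<star> x)" by (rule arg_cong)
      then have "u = (- (1/a)) \<star> x" using 1(1) UC[OF 1(2)] GC[OF 1(3)] by simp
      then have "- (1/a) * r \<le> 1" using GU[OF G(4)[OF 1(3)], of "- (1/a)"] 1(2) by simp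
      then show ?thesis using 1 by (simp add: field_simps)
    qed
  qed
  then obtain f where f: "real_linear f" and fK: "\<And>x r. (x, r) \<in> K \<Longrightarrow> f x \<le> r"
    using hahn_banach_cone by blast
  have fU: "f x \<le> 1" if x: "x \<in> U" for x using fK[OF KI[of 1 x zr 0]] x G(2) UC by simp
  have le: "f x \<le> r" if x: "(x, r) \<in> G" for x r
  proof (rule field_le_epsilon)
    fix e :: real assume "e > 0"
    then show "f x \<le> r + e" using fK[OF KI[OF _ z x, of e]] GC[OF x] by simp
  qed
  have "f x = r" if x: "(x, r) \<in> G" for x r
    using le[OF x] le[OF G(4)[OF x, of "-1"]] GC[OF x] by (simp add: real_linearD(2)[OF f])
  then show ?thesis using that f fU by blast
qed

end

section \<open>Locally convex spaces and their functionals\<close>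

locale kspace =
  fixes V :: "('k::real_or_complex, 'a) module" (structure)
  assumes vec_space: "vec_space V"
begin

lemma module: "Module.module (ring_of_type_algebra :: 'k ring) V"
  using vec_space by (simp add: vec_space_def)

lemma smult_closed [simp, intro]: "x \<in> carrier V \<Longrightarrow> (c::'k) \<odot> x \<in> carrier V"
  and smult_add_left: "x \<in> carrier V \<Longrightarrow> ((c::'k) + d) \<odot> x = c \<odot> x \<oplus> d \<odot> x"
  and smult_add_right: "x \<in> carrier V \<Longrightarrow> y \<in> carrier V \<Longrightarrow> c \<odot> (x \<oplus> y) = c \<odot> x \<oplus> c \<odot> y"
  and smult_smult: "x \<in> carrier V \<Longrightarrow> c \<odot> (d \<odot> x) = (c * d) \<odot> x"
  and smult_one [simp]: "x \<in> carrier V \<Longrightarrow> 1 \<odot> x = x"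
  and smult_zero [simp]: "x \<in> carrier V \<Longrightarrow> 0 \<odot> x = \<zero>"
  using module.smult_closed[OF module] module.smult_l_distr[OF module]
    module.smult_r_distr[OF module] module.smult_assoc1[OF module] module.smult_one[OF module]
    module.smult_l_null[OF module]
  by (auto simp: ring_of_type_algebra_def)

lemma abelian_group: "abelian_group V"
  using module by (simp add: Module.module_def)

sublocale real_space "carrier V" "add V" "zero V" "\<lambda>t x. (of_real t :: 'k) \<odot> x"
proof
  interpret abelian_group V by (rule abelian_group)
  show "x \<oplus> y \<in> carrier V" "x \<oplus> y = y \<oplus> x" if "x \<in> carrier V" "y \<in> carrier V" for x y
    using that by (auto simp: a_comm)
  show "x \<oplus> y \<oplus> u = x \<oplus> (y \<oplus> u)"
    if "x \<in> carrier V" "y \<in> carrier V" "u \<in> carrier V" for x y u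
    using that by (auto simp: a_assoc)
qed (auto simp: smult_add_left smult_add_right smult_smult
      intro: abelian_monoid.zero_closed[OF abelian_group.axioms(1)[OF abelian_group]]
      abelian_monoid.r_zero[OF abelian_group.axioms(1)[OF abelian_group]])

lemma convex_subset_iff: "convex_subset U \<longleftrightarrow> convex_in V U"
  by (simp add: convex_subset_def convex_in_def)

lemma carrier_convex: "convex_in V (carrier V)"
  by (auto simp: convex_in_def)

end

lemma linear_mapsD:
  assumes "f \<in> linear_maps V W"
  shows "x \<in> carrier V \<Longrightarrow> f x \<in> carrier W"
    "x \<in> carrier V \<Longrightarrow> y \<in> carrier V \<Longrightarrow> f (x \<oplus>\<^bsub>V\<^esub> y) = f x \<oplus>\<^bsub>W\<^esub> f y"
    "x \<in> carrier V \<Longrightarrow> f (c \<odot>\<^bsub>V\<^esub> x) = c \<odot>\<^bsub>W\<^esub> f x"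
    "f \<in> extensional (carrier V)"
  using assms by (auto simp: linear_maps_def PiE_def)

lemma linear_mapsI:
  assumes "\<And>x. x \<in> carrier V \<Longrightarrow> f x \<in> carrier W"
    "\<And>x y. x \<in> carrier V \<Longrightarrow> y \<in> carrier V \<Longrightarrow> f (x \<oplus>\<^bsub>V\<^esub> y) = f x \<oplus>\<^bsub>W\<^esub> f y"
    "\<And>c x. x \<in> carrier V \<Longrightarrow> f (c \<odot>\<^bsub>V\<^esub> x) = c \<odot>\<^bsub>W\<^esub> f x"
    "f \<in> extensional (carrier V)"
  shows "f \<in> linear_maps V W"
  using assms by (auto simp: linear_maps_def PiE_def)

lemma scalar_module_sel [simp]:
  "carrier scalar_module = UNIV" "add scalar_module = (+)" "smult scalar_module = (*)"
  "zero scalar_module = 0"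
  by (auto simp: scalar_module_def)

lemma carrier_alg_dual: "carrier (alg_dual V) = linear_maps V scalar_module"
  by (simp add: alg_dual_def)

lemma carrier_top_dual:
  "\<phi> \<in> carrier (top_dual (V, T)) \<longleftrightarrow>
    \<phi> \<in> linear_maps V scalar_module \<and> continuous_map T euclidean \<phi>"
  by (simp add: carrier_alg_dual)

declare top_dual.simps [simp del]

section \<open>Scalar-valued functionals and their real parts\<close>

context kspace begin

text \<open>At \<open>im_unit \<odot> x\<close> the hypothesis compares the real parts of
  \<open>im_unit * \<phi> x\<close> and \<open>im_unit * \<psi> x\<close> as well, and by
  \<open>scalar_decomp\<close> these two real parts determine the scalar.\<close>

lemma functional_eqI:
  assumes \<phi>: "\<phi> \<in> linear_maps V scalar_module" and \<psi>: "\<psi> \<in> linear_maps V scalar_module"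
    and eq: "\<And>x. x \<in> carrier V \<Longrightarrow> re_part (\<phi> x) = re_part (\<psi> x)"
  shows "\<phi> = \<psi>"
proof (rule extensionalityI[OF linear_mapsD(4)[OF \<phi>] linear_mapsD(4)[OF \<psi>]])
  fix x assume x: "x \<in> carrier V"
  have "re_part (im_unit * \<phi> x) = re_part (im_unit * \<psi> x)"
    using eq[of "im_unit \<odot> x"] x by (simp add: linear_mapsD(3)[OF \<phi>] linear_mapsD(3)[OF \<psi>])
  then show "\<phi> x = \<psi> x" using eq[OF x] scalar_decomp[of "\<phi> x"] scalar_decomp[of "\<psi> x"] by metis
qed

lemma real_linear_re_part:
  assumes "\<phi> \<in> linear_maps V scalar_module"
  shows "real_linear (\<lambda>x. re_part (\<phi> x))"
  using linear_mapsD[OF assms] by (auto simp: real_linear_def re_part_add re_part_of_real_mult)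

text \<open>The classical formula \<open>f x - i f (i x)\<close> for the functional with prescribed
  real part; for real scalars \<open>im_unit\<close> is 0 and only \<open>f x\<close>
  remains.\<close>

definition complexify :: "('a \<Rightarrow> real) \<Rightarrow> 'a \<Rightarrow> 'k" where
  "complexify f = (\<lambda>x\<in>carrier V. of_real (f x) - im_unit * of_real (f (im_unit \<odot> x)))"

lemma re_part_complexify:
  assumes "x \<in> carrier V"
  shows "re_part (complexify f x) = f x"
proof -
  have "re_part (of_real (f (im_unit \<odot> x)) * (im_unit :: 'k)) = 0"
    by (simp only: re_part_of_real_mult re_part_im_unit mult_zero_right)
  then show ?thesis using assms by (simp add: complexify_def re_part_diff mult.commute)
qed

lemma complexify_linear:
  assumes f: "real_linear f"
  shows "complexify f \<in> linear_maps V scalar_module"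
proof (rule linear_mapsI)
  let ?\<phi> = "complexify f" let ?i = "im_unit :: 'k"
  have add: "?\<phi> (x \<oplus> y) = ?\<phi> x + ?\<phi> y" if "x \<in> carrier V" "y \<in> carrier V" for x y
    using that by (simp add: complexify_def smult_add_right real_linearD[OF f] algebra_simps)
  have real: "?\<phi> (of_real t \<odot> x) = of_real t * ?\<phi> x" if x: "x \<in> carrier V" for t x
  proof -
    have "?i \<odot> (of_real t \<odot> x) = of_real t \<odot> (?i \<odot> x)"
      using x by (simp add: smult_smult mult.commute)
    then show ?thesis using x by (simp add: complexify_def real_linearD[OF f] algebra_simps)
  qed
  \<comment> \<open>The one place after the choice of \<open>im_unit\<close> where real and complex
    scalars are told apart.\<close>
  have im: "?\<phi> (?i \<odot> x) = ?i * ?\<phi> x" if x: "x \<in> carrier V" for x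
    using im_unit_cases[where 'a = 'k]
  proof
    assume "?i = 0"
    then show ?thesis using real[OF x, of 0] x by simp
  next
    assume ii: "?i * ?i = - 1"
    have "?i \<odot> (?i \<odot> x) = of_real (-1) \<odot> x" using x ii by (simp add: smult_smult)
    then have "f (?i \<odot> (?i \<odot> x)) = - f x" using real_linearD(2)[OF f x, of "-1"] by simp
    then have "?\<phi> (?i \<odot> x) = of_real (f (?i \<odot> x)) + ?i * of_real (f x)"
      using x by (simp add: complexify_def)
    also have "\<dots> = ?i * of_real (f x) - (?i * ?i) * of_real (f (?i \<odot> x))" by (simp add: ii)
    finally show ?thesis using x by (simp add: complexify_def algebra_simps)
  qed
  show "?\<phi> (x \<oplus> y) = ?\<phi> x \<oplus>\<^bsub>scalar_module\<^esub> ?\<phi> y" if "x \<in> carrier V" "y \<in> carrier V" for x y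
    using add[OF that] by simp
  show "?\<phi> (c \<odot> x) = c \<odot>\<^bsub>scalar_module\<^esub> ?\<phi> x" if x: "x \<in> carrier V" for c x
  proof -
    \<comment> \<open>Real coordinates of \<open>c\<close> with respect to 1 and
      \<open>im_unit\<close>, read off from \<open>scalar_decomp\<close>; they reduce homogeneity to
      \<open>real\<close> and \<open>im\<close>.\<close>
    define a b where "a = re_part c" and "b = - re_part (im_unit * c)"
    have c: "c = of_real a + of_real b * ?i"
      using scalar_decomp[of c] by (simp add: a_def b_def mult.commute)
    have "c \<odot> x = of_real a \<odot> x \<oplus> of_real b \<odot> (?i \<odot> x)"
      using x by (simp add: c smult_add_left smult_smult)
    then have "?\<phi> (c \<odot> x) = of_real a * ?\<phi> x + of_real b * (?i * ?\<phi> x)"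
      using x by (simp add: add real im)
    then show ?thesis by (simp add: c algebra_simps)
  qed
qed (auto simp: complexify_def)

end

text \<open>The class in which suprema and pullbacks are formed before separation of points is
  known.\<close>

definition lctvs :: "('k::real_or_complex, 'a) module \<Rightarrow> 'a topology \<Rightarrow> bool" where
  "lctvs V T \<longleftrightarrow> vec_space V \<and> topspace T = carrier V \<and>
     continuous_map (prod_topology T T) T (\<lambda>(x, y). x \<oplus>\<^bsub>V\<^esub> y) \<and>
     continuous_map (prod_topology euclidean T) T (\<lambda>(c, x). c \<odot>\<^bsub>V\<^esub> x) \<and>
     neighbourhood_base_at \<zero>\<^bsub>V\<^esub> (convex_in V) T"

lemma TVS_iff: "(V, T) \<in> TVS \<longleftrightarrow> lctvs V T \<and> Hausdorff_space T"
  by (auto simp: TVS_def lctvs_def)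

lemma lctvsD:
  assumes "lctvs V T"
  shows "vec_space V" "topspace T = carrier V"
    "continuous_map (prod_topology T T) T (\<lambda>(x, y). x \<oplus>\<^bsub>V\<^esub> y)"
    "continuous_map (prod_topology euclidean T) T (\<lambda>(c, x). c \<odot>\<^bsub>V\<^esub> x)"
    "neighbourhood_base_at \<zero>\<^bsub>V\<^esub> (convex_in V) T"
  using assms by (auto simp: lctvs_def)

text \<open>The convex set itself need not be open: \<open>neighbourhood_base_at\<close> only puts
  an open set inside it.\<close>

definition convex_nhd :: "('k::real_or_complex, 'a) module \<Rightarrow> 'a topology \<Rightarrow> 'a set \<Rightarrow> bool" where
  "convex_nhd V T U \<longleftrightarrow> convex_in V U \<and> (\<exists>N. openin T N \<and> \<zero>\<^bsub>V\<^esub> \<in> N \<and> N \<subseteq> U)"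

section \<open>Continuity of functionals as a one-sided bound near zero\<close>

context kspace begin

context
  fixes T assumes T: "lctvs V T"
begin

lemma ex_convex_nhd:
  assumes "openin T N" "\<zero> \<in> N"
  obtains U where "convex_nhd V T U" "U \<subseteq> N"
  using lctvsD(5)[OF T] assms unfolding neighbourhood_base_at_def convex_nhd_def by blast

lemma continuous_map_affine:
  assumes b: "b \<in> carrier V"
  shows "continuous_map T T (\<lambda>x. c \<odot> x \<oplus> b)"
proof -
  have "continuous_map T (prod_topology euclidean T) (\<lambda>x. (c, x))"
    by (simp add: continuous_map_pairedI)
  from continuous_map_compose[OF this lctvsD(4)[OF T]]
  have "continuous_map T T (\<lambda>x. c \<odot> x)" by (simp add: o_def)
  then have "continuous_map T (prod_topology T T) (\<lambda>x. (c \<odot> x, b))"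
    using b by (simp add: continuous_map_pairedI lctvsD(2)[OF T])
  from continuous_map_compose[OF this lctvsD(3)[OF T]] show ?thesis by (simp add: o_def)
qed

text \<open>The ray \<open>t \<mapsto> t x\<close> is continuous and passes through zero at
  \<open>t = 0\<close>.\<close>

lemma absorbing_convex_nhd:
  assumes "convex_nhd V T U"
  shows "absorbing U"
  unfolding absorbing_def
proof
  fix x assume x: "x \<in> carrier V"
  obtain N where N: "openin T N" "\<zero> \<in> N" "N \<subseteq> U" using assms by (auto simp: convex_nhd_def)
  have "continuous_map euclideanreal euclidean (of_real :: real \<Rightarrow> 'k)"
    by (simp add: continuous_on_of_real continuous_on_id)
  then have "continuous_map euclideanreal (prod_topology euclidean T) (\<lambda>t. ((of_real t :: 'k), x))"
    using x by (intro continuous_map_pairedI) (auto simp: lctvsD(2)[OF T])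
  from continuous_map_compose[OF this lctvsD(4)[OF T]]
  have "continuous_map euclideanreal T (\<lambda>t. (of_real t :: 'k) \<odot> x)" by (simp add: o_def)
  from openin_continuous_map_preimage[OF this N(1)]
  have "open {t. (of_real t :: 'k) \<odot> x \<in> N}" by simp
  moreover have "0 \<in> {t. (of_real t :: 'k) \<odot> x \<in> N}" using x N by simp
  ultimately obtain e where e: "e > 0" "ball 0 e \<subseteq> {t. (of_real t :: 'k) \<odot> x \<in> N}"
    using open_contains_ball by blast
  have "(of_real t :: 'k) \<odot> x \<in> U" if "0 < t" "t \<le> e/2" for t
    using e that N(3) by (force simp: subset_iff)
  then show "\<exists>e>0. \<forall>t. 0 < t \<and> t \<le> e \<longrightarrow> (of_real t :: 'k) \<odot> x \<in> U"
    using e(1) by (intro exI[of _ "e/2"]) auto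
qed

lemma continuous_map_real_linear:
  assumes f: "real_linear f" and U: "convex_nhd V T U" and fU: "\<And>x. x \<in> U \<Longrightarrow> f x \<le> 1"
  shows "continuous_map T euclideanreal f"
  unfolding continuous_map_def
proof (intro conjI allI impI)
  fix W :: "real set" assume "openin euclideanreal W"
  then have W: "open W" by simp
  obtain N where N: "openin T N" "\<zero> \<in> N" "N \<subseteq> U" using U by (auto simp: convex_nhd_def)
  show "openin T {x \<in> topspace T. f x \<in> W}"
  proof (subst openin_subopen, intro ballI)
    fix x assume "x \<in> {x \<in> topspace T. f x \<in> W}"
    then have x: "x \<in> carrier V" "f x \<in> W" by (auto simp: lctvsD(2)[OF T])
    obtain e where e: "e > 0" "\<And>r. dist r (f x) < e \<Longrightarrow> r \<in> W" using W x(2) by (auto simp: open_dist)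
    define k where "k = 2 / e"
    have k: "k > 0" using e by (simp add: k_def)
    \<comment> \<open>The multiples by \<open>k\<close> of \<open>y - x\<close> and of
      \<open>x - y\<close>: since \<open>U\<close> may be asymmetric, the one-sided bound is used in
      both directions.\<close>
    define p q where "p y = (of_real k :: 'k) \<odot> y \<oplus> of_real (- k) \<odot> x"
      and "q y = (of_real (- k) :: 'k) \<odot> y \<oplus> of_real k \<odot> x" for y
    have cont: "continuous_map T T p" "continuous_map T T q"
      unfolding p_def q_def using x by (auto intro!: continuous_map_affine)
    define M where "M = {y \<in> topspace T. p y \<in> N} \<inter> {y \<in> topspace T. q y \<in> N}"
    have "openin T M" unfolding M_def
      using cont N(1) by (intro openin_Int openin_continuous_map_preimage)
    moreover have "x \<in> M"
      using add_neg[OF x(1), of k] add_neg[OF x(1), of "- k"] N(2) x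
      by (simp add: M_def p_def q_def lctvsD(2)[OF T])
    moreover have "M \<subseteq> {x \<in> topspace T. f x \<in> W}"
    proof
      fix y assume y: "y \<in> M"
      then have yC: "y \<in> carrier V" by (auto simp: M_def lctvsD(2)[OF T])
      have "f (p y) = k * (f y - f x)" "f (q y) = k * (f x - f y)"
        unfolding p_def q_def using x yC
        by (simp_all only: real_linearD[OF f] smult_closed) (simp_all add: algebra_simps)
      moreover have "f (p y) \<le> 1" "f (q y) \<le> 1" using y N(3) fU by (auto simp: M_def)
      ultimately have "k * \<bar>f y - f x\<bar> \<le> 1" by (simp add: abs_if)
      then have "\<bar>f y - f x\<bar> \<le> e / 2" using e by (simp add: k_def field_simps)
      then have "dist (f y) (f x) < e" using e by (simp add: dist_real_def)
      then show "y \<in> {x \<in> topspace T. f x \<in> W}" using e(2) yC by (simp add: lctvsD(2)[OF T])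
    qed
    ultimately show "\<exists>M. openin T M \<and> x \<in> M \<and> M \<subseteq> {x \<in> topspace T. f x \<in> W}" by blast
  qed
qed auto

text \<open>With its converse \<open>functional_dominated\<close>, this trades continuous
  functionals for real functionals that are at most 1 on a convex neighbourhood, the form in which
  Hahn--Banach applies.\<close>

lemma dominated_functional:
  assumes f: "real_linear f" and U: "convex_nhd V T U" and fU: "\<And>x. x \<in> U \<Longrightarrow> f x \<le> 1"
  obtains \<phi> where "\<phi> \<in> carrier (top_dual (V, T))" "\<And>x. x \<in> carrier V \<Longrightarrow> re_part (\<phi> x) = f x"
proof
  have f_cont: "continuous_map T euclideanreal f" by (rule continuous_map_real_linear[OF f U fU])
  have "continuous_map T T (\<lambda>x. (im_unit :: 'k) \<odot> x \<oplus> \<zero>)" by (rule continuous_map_affine) auto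
  then have "continuous_map T T (\<lambda>x. (im_unit :: 'k) \<odot> x)"
    by (rule continuous_map_eq) (simp add: lctvsD(2)[OF T])
  from continuous_map_compose[OF this f_cont]
  have i_cont: "continuous_map T euclideanreal (\<lambda>x. f ((im_unit :: 'k) \<odot> x))" by (simp add: o_def)
  have c: "continuous_on UNIV (\<lambda>(r, s). of_real r - im_unit * (of_real s :: 'k))"
    unfolding split_beta by (intro continuous_intros)
  have "continuous_map T euclidean (\<lambda>x. (f x, f ((im_unit :: 'k) \<odot> x)))"
    using continuous_map_pairedI[OF f_cont i_cont] by (simp add: euclidean_product_topology)
  from continuous_map_compose[OF this, of euclidean "\<lambda>(r, s). of_real r - im_unit * (of_real s :: 'k)"] c
  have "continuous_map T euclidean (\<lambda>x. of_real (f x) - im_unit * (of_real (f (im_unit \<odot> x)) :: 'k))"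
    by (auto simp: o_def)
  then have "continuous_map T euclidean (complexify f)"
    by (rule continuous_map_eq) (simp add: complexify_def lctvsD(2)[OF T])
  then show "complexify f \<in> carrier (top_dual (V, T))"
    by (simp add: carrier_top_dual complexify_linear[OF f])
qed (rule re_part_complexify)

lemma functional_dominated:
  assumes "\<phi> \<in> carrier (top_dual (V, T))"
  obtains U where "convex_nhd V T U" "\<And>x. x \<in> U \<Longrightarrow> re_part (\<phi> x) \<le> 1"
proof -
  have \<phi>: "\<phi> \<in> linear_maps V scalar_module" "continuous_map T euclidean \<phi>"
    using assms by (auto simp: carrier_top_dual)
  have "continuous_map T euclideanreal (re_part \<circ> \<phi>)"
    using \<phi>(2) by (rule continuous_map_compose) (simp add: continuous_on_re_part)
  then have "openin T {x \<in> topspace T. (re_part \<circ> \<phi>) x \<in> {..<1}}"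
    by (rule openin_continuous_map_preimage) simp
  moreover have "re_part (\<phi> \<zero>) = 0"
    using real_linearD(2)[OF real_linear_re_part[OF \<phi>(1)], of \<zero> 0] by simp
  ultimately obtain U where "convex_nhd V T U" "U \<subseteq> {x \<in> topspace T. (re_part \<circ> \<phi>) x \<in> {..<1}}"
    using ex_convex_nhd[of "{x \<in> topspace T. (re_part \<circ> \<phi>) x \<in> {..<1}}"] by (auto simp: lctvsD(2)[OF T])
  then show ?thesis using that[of U] by force
qed

end
end

section \<open>Suprema and pullbacks of locally convex topologies\<close>

definition sup_top :: "'a topology set \<Rightarrow> 'a topology" where
  "sup_top \<T> = topology_generated_by {U. \<exists>T\<in>\<T>. openin T U}"

lemma openin_sup_top: "T \<in> \<T> \<Longrightarrow> openin T U \<Longrightarrow> openin (sup_top \<T>) U"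
  unfolding sup_top_def by (rule topology_generated_by_Basis) auto

lemma topspace_sup_top:
  assumes "\<T> \<noteq> {}" "\<And>T. T \<in> \<T> \<Longrightarrow> topspace T = C"
  shows "topspace (sup_top \<T>) = C"
proof -
  have "\<Union>{U. \<exists>T\<in>\<T>. openin T U} = C"
  proof
    show "\<Union>{U. \<exists>T\<in>\<T>. openin T U} \<subseteq> C" using assms(2) openin_subset by fastforce
    obtain T where "T \<in> \<T>" using assms(1) by blast
    then have "C \<in> {U. \<exists>T\<in>\<T>. openin T U}" using assms(2) openin_topspace[of T] by auto
    then show "C \<subseteq> \<Union>{U. \<exists>T\<in>\<T>. openin T U}" by blast
  qed
  then show ?thesis by (simp add: sup_top_def)
qed

lemma continuous_map_sup_topI:
  assumes "\<T> \<noteq> {}" "\<And>T. T \<in> \<T> \<Longrightarrow> continuous_map S T f"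
  shows "continuous_map S (sup_top \<T>) f"
  unfolding sup_top_def
proof (rule continuous_on_generated_topo)
  fix U assume "U \<in> {U. \<exists>T\<in>\<T>. openin T U}"
  then obtain T where T: "T \<in> \<T>" "openin T U" by blast
  have "f -` U \<inter> topspace S = {x \<in> topspace S. f x \<in> U}" by blast
  then show "openin S (f -` U \<inter> topspace S)"
    using openin_continuous_map_preimage[OF assms(2)[OF T(1)] T(2)] by simp
next
  obtain T where T: "T \<in> \<T>" using assms(1) by blast
  have "f ` topspace S \<subseteq> topspace T"
    using assms(2)[OF T] by (rule continuous_map_image_subset_topspace)
  then show "f ` topspace S \<subseteq> \<Union>{U. \<exists>T\<in>\<T>. openin T U}" using T openin_topspace[of T] by blast
qed

lemma continuous_map_sup_top_id:
  assumes "T \<in> \<T>" "\<And>T. T \<in> \<T> \<Longrightarrow> topspace T = C"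
  shows "continuous_map (sup_top \<T>) T (\<lambda>x. x)"
  unfolding continuous_map_def
proof (intro conjI allI impI)
  have top: "topspace (sup_top \<T>) = C" using assms by (intro topspace_sup_top) auto
  show "(\<lambda>x. x) \<in> topspace (sup_top \<T>) \<rightarrow> topspace T" using assms by (auto simp: top)
  fix U assume U: "openin T U"
  then have "{x \<in> topspace (sup_top \<T>). x \<in> U} = U"
    using openin_subset[OF U] assms by (auto simp: top)
  then show "openin (sup_top \<T>) {x \<in> topspace (sup_top \<T>). x \<in> U}"
    using openin_sup_top[OF assms(1) U] by simp
qed

lemma convex_nhd_sup_top:
  "T \<in> \<T> \<Longrightarrow> convex_nhd V T U \<Longrightarrow> convex_nhd V (sup_top \<T>) U"
  unfolding convex_nhd_def using openin_sup_top by blast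

lemma convex_nhd_Int:
  "convex_nhd V T U \<Longrightarrow> convex_nhd V T W \<Longrightarrow> convex_nhd V T (U \<inter> W)"
proof -
  assume a: "convex_nhd V T U" "convex_nhd V T W"
  then obtain M N where "openin T M" "\<zero>\<^bsub>V\<^esub> \<in> M" "M \<subseteq> U" "openin T N" "\<zero>\<^bsub>V\<^esub> \<in> N" "N \<subseteq> W"
    unfolding convex_nhd_def by blast
  then have "\<exists>N. openin T N \<and> \<zero>\<^bsub>V\<^esub> \<in> N \<and> N \<subseteq> U \<inter> W" by (intro exI[of _ "M \<inter> N"]) auto
  moreover have "convex_in V (U \<inter> W)" using a unfolding convex_nhd_def convex_in_def by blast
  ultimately show ?thesis by (simp add: convex_nhd_def)
qed

context kspace begin

lemma carrier_convex_nhd: "topspace T = carrier V \<Longrightarrow> convex_nhd V T (carrier V)"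
  unfolding convex_nhd_def using carrier_convex openin_topspace[of T] zr_closed by auto

context
  fixes \<T> assumes ne: "\<T> \<noteq> {}" and \<T>: "\<And>T. T \<in> \<T> \<Longrightarrow> lctvs V T"
begin

text \<open>Induction over the generation of open sets: an intersection collects the neighbourhoods
  of both sides, a union keeps one member containing zero. The factor \<open>carrier V\<close>
  covers the empty family, whose intersection is the whole type.\<close>

lemma sup_top_basic_nhd:
  assumes "openin (sup_top \<T>) N" "\<zero> \<in> N"
  obtains \<U> where "finite \<U>" "\<And>U. U \<in> \<U> \<Longrightarrow> \<exists>T\<in>\<T>. convex_nhd V T U" "carrier V \<inter> \<Inter>\<U> \<subseteq> N"
proof -
  have "generate_topology_on {U. \<exists>T\<in>\<T>. openin T U} N"
    using assms(1) unfolding sup_top_def by (rule openin_topology_generated_by)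
  then have "\<zero> \<in> N \<Longrightarrow> \<exists>\<U>. finite \<U> \<and> (\<forall>U\<in>\<U>. \<exists>T\<in>\<T>. convex_nhd V T U) \<and> carrier V \<inter> \<Inter>\<U> \<subseteq> N"
  proof induction
    case (Int a b)
    then obtain \<U> \<W> where "finite \<U>" "\<forall>U\<in>\<U>. \<exists>T\<in>\<T>. convex_nhd V T U" "carrier V \<inter> \<Inter>\<U> \<subseteq> a"
      "finite \<W>" "\<forall>U\<in>\<W>. \<exists>T\<in>\<T>. convex_nhd V T U" "carrier V \<inter> \<Inter>\<W> \<subseteq> b" by auto
    then show ?case by (intro exI[of _ "\<U> \<union> \<W>"]) auto
  next
    case (UN K)
    then obtain k where k: "k \<in> K" "\<zero> \<in> k" by blast
    obtain \<U> where "finite \<U>" "\<forall>U\<in>\<U>. \<exists>T\<in>\<T>. convex_nhd V T U" "carrier V \<inter> \<Inter>\<U> \<subseteq> k"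
      using UN.IH[OF k] by blast
    with k(1) show ?case by (intro exI[of _ \<U>]) auto
  next
    case (Basis s)
    then obtain T where T: "T \<in> \<T>" "openin T s" by blast
    then obtain U where "convex_nhd V T U" "U \<subseteq> s"
      using ex_convex_nhd[OF \<T>[OF T(1)] T(2) Basis(2)] by blast
    with T show ?case by (intro exI[of _ "{U}"]) auto
  qed auto
  then show ?thesis using that assms(2) by blast
qed

lemma top_sup: "topspace (sup_top \<T>) = carrier V"
  using ne lctvsD(2)[OF \<T>] by (rule topspace_sup_top)

lemma convex_nhd_finite_Inter:
  assumes "finite \<U>" "\<And>U. U \<in> \<U> \<Longrightarrow> \<exists>T\<in>\<T>. convex_nhd V T U"
  shows "convex_nhd V (sup_top \<T>) (carrier V \<inter> \<Inter>\<U>)"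
  using assms
proof (induction \<U> rule: finite_induct)
  case empty
  then show ?case using carrier_convex_nhd[OF top_sup] by simp
next
  case (insert U \<U>)
  have "convex_nhd V (sup_top \<T>) U" using insert.prems by (auto intro: convex_nhd_sup_top)
  moreover have "convex_nhd V (sup_top \<T>) (carrier V \<inter> \<Inter>\<U>)" using insert by blast
  ultimately have "convex_nhd V (sup_top \<T>) (U \<inter> (carrier V \<inter> \<Inter>\<U>))"
    by (rule convex_nhd_Int)
  then show ?case by (simp add: Int_left_commute)
qed

lemma lctvs_sup_top: "lctvs V (sup_top \<T>)"
  unfolding lctvs_def
proof (intro conjI)
  show "vec_space V" by (rule vec_space)
  show "topspace (sup_top \<T>) = carrier V" by (rule top_sup)
  show "continuous_map (prod_topology (sup_top \<T>) (sup_top \<T>)) (sup_top \<T>) (\<lambda>(x, y). x \<oplus> y)"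
  proof (rule continuous_map_sup_topI[OF ne])
    fix T assume T: "T \<in> \<T>"
    have "continuous_map (sup_top \<T>) T (\<lambda>x. x)"
      using T lctvsD(2)[OF \<T>] by (rule continuous_map_sup_top_id)
    then have "continuous_map (prod_topology (sup_top \<T>) (sup_top \<T>)) (prod_topology T T) (\<lambda>(x, y). (x, y))"
      by (intro continuous_map_prod_top[THEN iffD2] disjI2 conjI)
    from continuous_map_compose[OF this lctvsD(3)[OF \<T>[OF T]]]
    show "continuous_map (prod_topology (sup_top \<T>) (sup_top \<T>)) T (\<lambda>(x, y). x \<oplus> y)"
      by (rule continuous_map_eq) auto
  qed
  show "continuous_map (prod_topology euclidean (sup_top \<T>)) (sup_top \<T>) (\<lambda>(c, x). c \<odot> x)"
  proof (rule continuous_map_sup_topI[OF ne])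
    fix T assume T: "T \<in> \<T>"
    have "continuous_map (sup_top \<T>) T (\<lambda>x. x)"
      using T lctvsD(2)[OF \<T>] by (rule continuous_map_sup_top_id)
    then have "continuous_map (prod_topology (euclidean :: 'k topology) (sup_top \<T>)) (prod_topology euclidean T) (\<lambda>(x, y). (x, y))"
      by (intro continuous_map_prod_top[THEN iffD2] disjI2 conjI continuous_map_id[unfolded id_def])
    from continuous_map_compose[OF this lctvsD(4)[OF \<T>[OF T]]]
    show "continuous_map (prod_topology euclidean (sup_top \<T>)) T (\<lambda>(c, x). c \<odot> x)"
      by (rule continuous_map_eq) auto
  qed
  show "neighbourhood_base_at \<zero> (convex_in V) (sup_top \<T>)"
    unfolding neighbourhood_base_at_def
  proof (intro allI impI)
    fix N assume "openin (sup_top \<T>) N \<and> \<zero> \<in> N"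
    then obtain \<U> where "finite \<U>" "\<And>U. U \<in> \<U> \<Longrightarrow> \<exists>T\<in>\<T>. convex_nhd V T U" "carrier V \<inter> \<Inter>\<U> \<subseteq> N"
      using sup_top_basic_nhd by blast
    then have "convex_nhd V (sup_top \<T>) (carrier V \<inter> \<Inter>\<U>)" "carrier V \<inter> \<Inter>\<U> \<subseteq> N"
      using convex_nhd_finite_Inter[of \<U>] by auto
    then show "\<exists>U W. openin (sup_top \<T>) U \<and> convex_in V W \<and> \<zero> \<in> U \<and> U \<subseteq> W \<and> W \<subseteq> N"
      unfolding convex_nhd_def by blast
  qed
qed

text \<open>A functional bounded on a finite intersection of neighbourhoods is split into summands, each
  of which is bounded on one of them.\<close>

lemma top_dual_sup_top:
  assumes F: "\<And>T. T \<in> \<T> \<Longrightarrow> carrier (top_dual (V, T)) \<subseteq> F"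
    and F_add: "\<And>\<phi> \<psi>. \<phi> \<in> F \<Longrightarrow> \<psi> \<in> F \<Longrightarrow> (\<lambda>x\<in>carrier V. \<phi> x + \<psi> x) \<in> F"
    and F_lin: "F \<subseteq> linear_maps V scalar_module"
  shows "carrier (top_dual (V, sup_top \<T>)) \<subseteq> F"
proof
  have dominated: "\<exists>\<phi>\<in>F. \<forall>x\<in>carrier V. re_part (\<phi> x) = f x"
    if "T \<in> \<T>" "real_linear f" "convex_nhd V T U" "\<And>x. x \<in> U \<Longrightarrow> f x \<le> 1" for T f U
    using dominated_functional[OF \<T>[OF that(1)] that(2-4)] F[OF that(1)] by (metis subsetD)
  \<comment> \<open>The induction runs over real functionals, since splitting yields real summands;
    \<open>dominated\<close> lifts each summand to a member of \<open>F\<close>, and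
    \<open>F_add\<close> adds them up.\<close>
  have finite: "\<exists>\<phi>\<in>F. \<forall>x\<in>carrier V. re_part (\<phi> x) = f x"
    if "finite \<U>" "\<And>U. U \<in> \<U> \<Longrightarrow> \<exists>T\<in>\<T>. convex_nhd V T U" "real_linear f"
      "\<And>x. x \<in> carrier V \<inter> \<Inter>\<U> \<Longrightarrow> f x \<le> 1" for \<U> f
    using that
  proof (induction \<U> arbitrary: f rule: finite_induct)
    case empty
    \<comment> \<open>The empty family makes \<open>f\<close> at most 1 on the whole carrier, which
      is a convex neighbourhood for any member of \<open>\<T>\<close>.\<close>
    obtain T where T: "T \<in> \<T>" using ne by blast
    show ?case
      using dominated[OF T empty(2) carrier_convex_nhd[OF lctvsD(2)[OF \<T>[OF T]]]] empty(3) by simp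
  next
    case (insert U \<U>)
    obtain T where T: "T \<in> \<T>" "convex_nhd V T U" using insert.prems(1) by blast
    let ?W = "carrier V \<inter> \<Inter>\<U>"
    \<comment> \<open>In general \<open>?W\<close> is a neighbourhood for the supremum only; the
      decomposition asks of it just convexity and absorption.\<close>
    have W: "convex_nhd V (sup_top \<T>) ?W" using insert by (intro convex_nhd_finite_Inter) auto
    have U: "convex_subset U" "absorbing U" "convex_subset ?W" "absorbing ?W"
      using absorbing_convex_nhd[OF \<T>[OF T(1)] T(2)] absorbing_convex_nhd[OF lctvs_sup_top W] T(2) W
      by (auto simp: convex_nhd_def convex_subset_iff)
    obtain g where g: "real_linear g" "\<And>x. x \<in> U \<Longrightarrow> g x \<le> 1" "\<And>x. x \<in> ?W \<Longrightarrow> f x - g x \<le> 1"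
      using dominated_sum_decomposition[OF U insert.prems(2)] insert.prems(3) by auto
    obtain \<phi> where \<phi>: "\<phi> \<in> F" "\<And>x. x \<in> carrier V \<Longrightarrow> re_part (\<phi> x) = g x"
      using dominated[OF T(1) g(1) T(2) g(2)] by blast
    have "real_linear (\<lambda>x. f x - g x)"
      using insert.prems(2) g(1) by (auto simp: real_linear_def algebra_simps)
    then obtain \<psi> where \<psi>: "\<psi> \<in> F" "\<And>x. x \<in> carrier V \<Longrightarrow> re_part (\<psi> x) = f x - g x"
      using insert.IH[of "\<lambda>x. f x - g x"] insert.prems(1) g(3) by auto
    show ?case using F_add[OF \<phi>(1) \<psi>(1)] \<phi>(2) \<psi>(2) by (intro bexI) (auto simp: re_part_add)
  qed
  fix \<phi> assume \<phi>: "\<phi> \<in> carrier (top_dual (V, sup_top \<T>))"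
  then have lin: "\<phi> \<in> linear_maps V scalar_module" by (simp add: carrier_top_dual)
  obtain U where U: "convex_nhd V (sup_top \<T>) U" "\<And>x. x \<in> U \<Longrightarrow> re_part (\<phi> x) \<le> 1"
    using functional_dominated[OF lctvs_sup_top \<phi>] by blast
  then obtain N where "openin (sup_top \<T>) N" "\<zero> \<in> N" "N \<subseteq> U" unfolding convex_nhd_def by blast
  then obtain \<U> where \<U>: "finite \<U>" "\<And>U. U \<in> \<U> \<Longrightarrow> \<exists>T\<in>\<T>. convex_nhd V T U" "carrier V \<inter> \<Inter>\<U> \<subseteq> U"
    using sup_top_basic_nhd[of N] by (metis order_trans)
  then obtain \<psi> where \<psi>: "\<psi> \<in> F" "\<forall>x\<in>carrier V. re_part (\<psi> x) = re_part (\<phi> x)"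
    using finite[OF \<U>(1,2) real_linear_re_part[OF lin]] U(2) by blast
  then have "\<phi> = \<psi>" using functional_eqI[OF lin, of \<psi>] F_lin by auto
  then show "\<phi> \<in> F" using \<psi> by simp
qed

end

section \<open>Pullback along a linear map\<close>

lemma lctvs_pullback:
  assumes A: "A \<in> linear_maps V W" and T: "lctvs W T"
  shows "lctvs V (pullback_topology (carrier V) A T)" (is "lctvs V ?P")
  unfolding lctvs_def
proof (intro conjI)
  show "vec_space V" by (rule vec_space)
  note A' = linear_mapsD[OF A]
  show top: "topspace ?P = carrier V"
    using A'(1) by (auto simp: topspace_pullback_topology lctvsD(2)[OF T])
  have contA: "continuous_map ?P T A"
    using continuous_map_pullback[OF continuous_map_id[of T], of "carrier V" A] by (simp add: o_def)
  show "continuous_map (prod_topology ?P ?P) ?P (\<lambda>(x, y). x \<oplus> y)"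
  proof (rule continuous_map_pullback')
    have "continuous_map (prod_topology ?P ?P) (prod_topology T T) (\<lambda>(x, y). (A x, A y))"
      using contA by (simp add: continuous_map_prod_top)
    from continuous_map_compose[OF this lctvsD(3)[OF T]]
    show "continuous_map (prod_topology ?P ?P) T (A \<circ> (\<lambda>(x, y). x \<oplus> y))"
      by (rule continuous_map_eq) (auto simp: top A')
  qed (auto simp: top)
  show "continuous_map (prod_topology euclidean ?P) ?P (\<lambda>(c, x). c \<odot> x)"
  proof (rule continuous_map_pullback')
    have "continuous_map (prod_topology (euclidean :: 'k topology) ?P) (prod_topology euclidean T) (\<lambda>(c, x). (c, A x))"
      using contA by (simp add: continuous_map_prod_top)
    from continuous_map_compose[OF this lctvsD(4)[OF T]]
    show "continuous_map (prod_topology euclidean ?P) T (A \<circ> (\<lambda>(c, x). c \<odot> x))"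
      by (rule continuous_map_eq) (auto simp: top A')
  qed (auto simp: top)
  interpret W: kspace W by unfold_locales (rule lctvsD(1)[OF T])
  have A0: "A \<zero> = \<zero>\<^bsub>W\<^esub>" using A'(3)[of \<zero> 0] A'(1) by simp
  show "neighbourhood_base_at \<zero> (convex_in V) ?P"
    unfolding neighbourhood_base_at_def
  proof (intro allI impI)
    fix N assume N: "openin ?P N \<and> \<zero> \<in> N"
    then obtain M where M: "openin T M" "N = A -` M \<inter> carrier V" by (auto simp: openin_pullback_topology)
    then obtain U where U: "convex_nhd W T U" "U \<subseteq> M"
      using W.ex_convex_nhd[OF T M(1)] N A0 by auto
    then obtain L where L: "openin T L" "\<zero>\<^bsub>W\<^esub> \<in> L" "L \<subseteq> U" unfolding convex_nhd_def by blast
    have "convex_in V (A -` U \<inter> carrier V)"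
      using U(1) unfolding convex_nhd_def convex_in_def by (auto simp: A')
    moreover have "openin ?P (A -` L \<inter> carrier V)"
      using L(1) by (auto simp: openin_pullback_topology)
    ultimately show "\<exists>U W. openin ?P U \<and> convex_in V W \<and> \<zero> \<in> U \<and> U \<subseteq> W \<and> W \<subseteq> N"
      using L(2,3) U(2) M(2) A0
      by (intro exI[of _ "A -` L \<inter> carrier V"] exI[of _ "A -` U \<inter> carrier V"]) auto
  qed
qed

text \<open>The values of \<open>re_part\<close> of \<open>\<phi>\<close>, attached to the points
  \<open>A x\<close>, form a relation on the range of \<open>A\<close> that is at most 1 on
  \<open>L\<close>. Its extension to \<open>W\<close>, dominated on \<open>L\<close>, is the real
  part of the wanted \<open>\<psi>\<close>.\<close>

lemma top_dual_pullback:
  assumes A: "A \<in> linear_maps V W" and T: "lctvs W T"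
    and \<phi>: "\<phi> \<in> carrier (top_dual (V, pullback_topology (carrier V) A T))"
  obtains \<psi> where "\<psi> \<in> carrier (top_dual (W, T))" "\<phi> = compose (carrier V) \<psi> A"
proof -
  note A' = linear_mapsD[OF A]
  let ?P = "pullback_topology (carrier V) A T"
  interpret W: kspace W by unfold_locales (rule lctvsD(1)[OF T])
  have A0: "A \<zero> = \<zero>\<^bsub>W\<^esub>" using A'(3)[of \<zero> 0] A'(1) by simp
  have lin: "\<phi> \<in> linear_maps V scalar_module" using \<phi> by (simp add: carrier_top_dual)
  note re = real_linearD[OF real_linear_re_part[OF lin]]
  obtain U where U: "convex_nhd V ?P U" "\<And>x. x \<in> U \<Longrightarrow> re_part (\<phi> x) \<le> 1"
    using functional_dominated[OF lctvs_pullback[OF A T] \<phi>] by blast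
  then obtain N where N: "openin ?P N" "\<zero> \<in> N" "N \<subseteq> U" unfolding convex_nhd_def by blast
  then obtain M where M: "openin T M" "N = A -` M \<inter> carrier V" by (auto simp: openin_pullback_topology)
  then obtain L where L: "convex_nhd W T L" "L \<subseteq> M"
    using W.ex_convex_nhd[OF T M(1)] N A0 by auto
  \<comment> \<open>That points with equal image have equal values comes out of
    \<open>dominated_extension\<close>.\<close>
  define G where "G = {(A x, re_part (\<phi> x)) | x. x \<in> carrier V}"
  have GI: "(A x, re_part (\<phi> x)) \<in> G" if "x \<in> carrier V" for x using that by (auto simp: G_def)
  obtain f where f: "W.real_linear f" "\<And>y. y \<in> L \<Longrightarrow> f y \<le> 1" "\<And>y r. (y, r) \<in> G \<Longrightarrow> f y = r"
  proof (rule W.dominated_extension)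
    show "W.convex_subset L" using L by (simp add: convex_nhd_def W.convex_subset_iff)
    show "W.absorbing L" using T L(1) by (rule W.absorbing_convex_nhd)
    show "G \<subseteq> carrier W \<times> UNIV" using A'(1) by (auto simp: G_def)
    show "(\<zero>\<^bsub>W\<^esub>, 0) \<in> G" using GI[of \<zero>] A0 re(2)[of \<zero> 0] by simp
    show "(y \<oplus>\<^bsub>W\<^esub> y', r + r') \<in> G" if "(y, r) \<in> G" "(y', r') \<in> G" for y r y' r'
    proof -
      from that obtain x x' where "x \<in> carrier V" "x' \<in> carrier V" "y = A x" "y' = A x'"
        "r = re_part (\<phi> x)" "r' = re_part (\<phi> x')" by (auto simp: G_def)
      then show ?thesis using GI[of "x \<oplus> x'"] by (simp add: A' re)
    qed
    show "(of_real t \<odot>\<^bsub>W\<^esub> y, t * r) \<in> G" if "(y, r) \<in> G" for y r t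
    proof -
      from that obtain x where "x \<in> carrier V" "y = A x" "r = re_part (\<phi> x)" by (auto simp: G_def)
      then show ?thesis using GI[of "of_real t \<odot> x"] by (simp add: A' re)
    qed
    show "r \<le> 1" if "(y, r) \<in> G" "y \<in> L" for y r
      using that L(2) M(2) N(3) U(2) by (auto simp: G_def)
  qed blast
  obtain \<psi> where \<psi>: "\<psi> \<in> carrier (top_dual (W, T))" "\<And>y. y \<in> carrier W \<Longrightarrow> re_part (\<psi> y) = f y"
    using W.dominated_functional[OF T f(1) L(1) f(2)] by blast
  have \<psi>_lin: "\<psi> \<in> linear_maps W scalar_module" using \<psi> by (simp add: carrier_top_dual)
  have "compose (carrier V) \<psi> A \<in> linear_maps V scalar_module"
    by (rule linear_mapsI) (auto simp: compose_def A' linear_mapsD[OF \<psi>_lin])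
  then have "\<phi> = compose (carrier V) \<psi> A"
    using \<psi>(2) f(3)[OF GI] by (intro functional_eqI lin) (auto simp: compose_def A')
  with \<psi>(1) show ?thesis by (rule that)
qed

end

section \<open>The weak and the Mackey topology of a dual pair\<close>

lemma vec_space_scalar_module: "vec_space (scalar_module :: ('k::real_or_complex, 'k) module)"
  unfolding vec_space_def
proof (rule moduleI)
  show "cring (ring_of_type_algebra :: 'k ring)" by (rule cring_from_type_algebra)
  show "abelian_group (scalar_module :: ('k, 'k) module)"
  proof (rule abelian_groupI)
    fix x :: 'k
    show "\<exists>y\<in>carrier (scalar_module :: ('k, 'k) module).
      y \<oplus>\<^bsub>(scalar_module :: ('k, 'k) module)\<^esub> x = \<zero>\<^bsub>(scalar_module :: ('k, 'k) module)\<^esub>"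
      by (auto intro: exI[of _ "- x"])
  qed (auto simp: algebra_simps)
qed (auto simp: ring_of_type_algebra_def algebra_simps)

text \<open>A functional becomes a linear map into a locally convex space, so the pullback lemmas
  cover the initial topology of a functional.\<close>

lemma lctvs_scalar_module: "lctvs (scalar_module :: ('k::real_or_complex, 'k) module) euclidean"
  unfolding lctvs_def
proof (intro conjI)
  have "continuous_on UNIV (\<lambda>p :: 'k \<times> 'k. fst p + snd p)" by (intro continuous_intros)
  then show "continuous_map (prod_topology euclidean euclidean) euclidean
      (\<lambda>(x, y). x \<oplus>\<^bsub>(scalar_module :: ('k, 'k) module)\<^esub> y)"
    by (simp add: euclidean_product_topology split_beta)
  have "continuous_on UNIV (\<lambda>p :: 'k \<times> 'k. fst p * snd p)" by (intro continuous_intros)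
  then show "continuous_map (prod_topology euclidean euclidean) euclidean
      (\<lambda>(x, y). x \<odot>\<^bsub>(scalar_module :: ('k, 'k) module)\<^esub> y)"
    by (simp add: euclidean_product_topology split_beta)
  show "neighbourhood_base_at \<zero>\<^bsub>(scalar_module :: ('k, 'k) module)\<^esub> (convex_in scalar_module) euclidean"
    unfolding neighbourhood_base_at_def
  proof (intro allI impI)
    fix N :: "'k set" assume "openin euclidean N \<and> \<zero>\<^bsub>(scalar_module :: ('k, 'k) module)\<^esub> \<in> N"
    then obtain e where e: "e > 0" "ball 0 e \<subseteq> N" using open_contains_ball[of N] by fastforce
    have "convex_in (scalar_module :: ('k, 'k) module) (ball 0 e)"
      unfolding convex_in_def
    proof (intro conjI ballI allI impI)
      fix x y :: 'k and t :: real
      assume "x \<in> ball 0 e" "y \<in> ball 0 e" "0 \<le> t \<and> t \<le> 1"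
      then have "t *\<^sub>R x + (1 - t) *\<^sub>R y \<in> ball 0 e" by (intro convexD[OF convex_ball]) auto
      then show "of_real t \<odot>\<^bsub>scalar_module\<^esub> x \<oplus>\<^bsub>scalar_module\<^esub> of_real (1 - t) \<odot>\<^bsub>scalar_module\<^esub> y \<in> ball 0 e"
        by (simp add: scaleR_conv_of_real)
    qed simp
    then show "\<exists>U W. openin euclidean U \<and> convex_in scalar_module W \<and>
        \<zero>\<^bsub>(scalar_module :: ('k, 'k) module)\<^esub> \<in> U \<and> U \<subseteq> W \<and> W \<subseteq> N"
      using e by (intro exI[of _ "ball 0 e"]) auto
  qed
qed (auto simp: vec_space_scalar_module)

definition compatible ::
    "('k::real_or_complex, 'a) module \<Rightarrow> ('a \<Rightarrow> 'k) set \<Rightarrow> 'a topology \<Rightarrow> bool" where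
  "compatible V F T \<longleftrightarrow> lctvs V T \<and> carrier (top_dual (V, T)) \<subseteq> F"

definition weak_top :: "('k::real_or_complex, 'a) module \<Rightarrow> ('a \<Rightarrow> 'k) set \<Rightarrow> 'a topology" where
  "weak_top V F = sup_top ((\<lambda>\<phi>. pullback_topology (carrier V) \<phi> euclidean) ` F)"

text \<open>Defined by its extremal property; \<open>compatible_mackey_top\<close> shows that the
  supremum belongs to the family itself.\<close>

definition mackey_top :: "('k::real_or_complex, 'a) module \<Rightarrow> ('a \<Rightarrow> 'k) set \<Rightarrow> 'a topology" where
  "mackey_top V F = sup_top {T. compatible V F T}"

text \<open>\<open>dual_topology\<close> with the second space of the pair replaced by its image in
  the algebraic dual.\<close>

definition has_dual :: "('k::real_or_complex, 'a) module \<Rightarrow> ('a \<Rightarrow> 'k) set \<Rightarrow> 'a topology \<Rightarrow> bool" where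
  "has_dual V F T \<longleftrightarrow> (V, T) \<in> TVS \<and> carrier (top_dual (V, T)) = F"

locale dual_pair = kspace V for V :: "('k::real_or_complex, 'a) module" (structure) +
  fixes F :: "('a \<Rightarrow> 'k) set"
  assumes F_linear: "F \<subseteq> linear_maps V scalar_module"
    and F_nonempty: "F \<noteq> {}"
    and F_add: "\<And>\<phi> \<psi>. \<phi> \<in> F \<Longrightarrow> \<psi> \<in> F \<Longrightarrow> (\<lambda>x\<in>carrier V. \<phi> x + \<psi> x) \<in> F"
    and F_smult: "\<And>c \<phi>. \<phi> \<in> F \<Longrightarrow> (\<lambda>x\<in>carrier V. c * \<phi> x) \<in> F"
    and F_separating: "\<And>x y. x \<in> carrier V \<Longrightarrow> y \<in> carrier V \<Longrightarrow>
      (\<And>\<phi>. \<phi> \<in> F \<Longrightarrow> \<phi> x = \<phi> y) \<Longrightarrow> x = y"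
begin

lemma compatible_pullback:
  assumes "\<phi> \<in> F"
  shows "compatible V F (pullback_topology (carrier V) \<phi> euclidean)"
  unfolding compatible_def
proof
  have \<phi>: "\<phi> \<in> linear_maps V scalar_module" using assms F_linear by blast
  show "lctvs V (pullback_topology (carrier V) \<phi> euclidean)"
    by (rule lctvs_pullback[OF \<phi> lctvs_scalar_module])
  show "carrier (top_dual (V, pullback_topology (carrier V) \<phi> euclidean)) \<subseteq> F"
  proof
    fix \<eta> assume "\<eta> \<in> carrier (top_dual (V, pullback_topology (carrier V) \<phi> euclidean))"
    then obtain \<psi> where \<psi>: "\<psi> \<in> carrier (top_dual (scalar_module, euclidean))"
      "\<eta> = compose (carrier V) \<psi> \<phi>"
      using top_dual_pullback[OF \<phi> lctvs_scalar_module] by blast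
    \<comment> \<open>A linear endomorphism of the scalars is multiplication by its value at 1, so
      \<open>\<eta>\<close> is a multiple of \<open>\<phi>\<close>.\<close>
    have "\<psi> z = \<psi> 1 * z" for z
      using linear_mapsD(3)[of \<psi> scalar_module scalar_module 1 z] \<psi>(1)
      by (simp add: carrier_top_dual mult.commute)
    then have "\<eta> = (\<lambda>x\<in>carrier V. \<psi> 1 * \<phi> x)" unfolding \<psi>(2) compose_def by metis
    then show "\<eta> \<in> F" using F_smult[OF assms] by simp
  qed
qed

lemma compatible_sup_top:
  assumes "\<T> \<noteq> {}" "\<And>T. T \<in> \<T> \<Longrightarrow> compatible V F T"
  shows "compatible V F (sup_top \<T>)"
  using assms lctvs_sup_top[of \<T>] top_dual_sup_top[of \<T> F] F_add F_linear
  by (simp add: compatible_def)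

lemma compatible_weak_top: "compatible V F (weak_top V F)"
  unfolding weak_top_def using F_nonempty compatible_pullback by (intro compatible_sup_top) auto

text \<open>The weak topology witnesses that the family under the supremum is not empty.\<close>

lemma compatible_mackey_top: "compatible V F (mackey_top V F)"
  unfolding mackey_top_def using compatible_weak_top by (intro compatible_sup_top) auto

lemma continuous_map_pullback_self:
  "continuous_map (pullback_topology (carrier V) \<phi> T) T \<phi>"
  using continuous_map_pullback[OF continuous_map_id[of T], of "carrier V" \<phi>] by simp

lemma openin_weak_top_mono:
  assumes "topspace T = carrier V" "\<And>\<phi>. \<phi> \<in> F \<Longrightarrow> continuous_map T euclidean \<phi>" "openin (weak_top V F) U"
  shows "openin T U"
proof -
  have "continuous_map T (weak_top V F) (\<lambda>x. x)"
    unfolding weak_top_def using assms(1,2) F_nonempty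
    by (intro continuous_map_sup_topI) (auto intro!: continuous_map_pullback' simp: o_def)
  from openin_continuous_map_preimage[OF this assms(3)]
  have "openin T {x \<in> topspace T. x \<in> U}" .
  moreover have "U \<subseteq> topspace T"
    using openin_subset[OF assms(3)] lctvsD(2) compatible_weak_top assms(1)
    by (auto simp: compatible_def)
  ultimately show ?thesis by (simp add: Collect_conj_eq Int_absorb1)
qed

text \<open>Continuity of all of \<open>F\<close> supplies what \<open>compatible\<close> leaves
  open: the reverse inclusion of the dual and, as \<open>F\<close> separates points, the Hausdorff
  property.\<close>

lemma has_dualI:
  assumes T: "compatible V F T" and cont: "\<And>\<phi>. \<phi> \<in> F \<Longrightarrow> continuous_map T euclidean \<phi>"
  shows "has_dual V F T"
proof -
  have top: "topspace T = carrier V" using T by (simp add: compatible_def lctvsD(2))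
  have "Hausdorff_space T" unfolding Hausdorff_space_def
  proof (intro allI impI)
    fix x y assume xy: "x \<in> topspace T \<and> y \<in> topspace T \<and> x \<noteq> y"
    then obtain \<phi> where \<phi>: "\<phi> \<in> F" "\<phi> x \<noteq> \<phi> y" using F_separating[of x y] top by auto
    obtain A B where AB: "open A" "open B" "\<phi> x \<in> A" "\<phi> y \<in> B" "A \<inter> B = {}"
      using hausdorff[OF \<phi>(2)] by blast
    have "openin T {z \<in> topspace T. \<phi> z \<in> A}" "openin T {z \<in> topspace T. \<phi> z \<in> B}"
      using AB cont[OF \<phi>(1)] by (auto intro!: openin_continuous_map_preimage)
    then show "\<exists>U W. openin T U \<and> openin T W \<and> x \<in> U \<and> y \<in> W \<and> disjnt U W"
      using AB xy by (intro exI[of _ "{z \<in> topspace T. \<phi> z \<in> A}"] exI[of _ "{z \<in> topspace T. \<phi> z \<in> B}"])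
        (auto simp: disjnt_iff)
  qed
  then show ?thesis
    using T cont F_linear by (auto simp: has_dual_def TVS_iff compatible_def carrier_top_dual)
qed

lemma has_dual_weak_top: "has_dual V F (weak_top V F)"
proof (rule has_dualI[OF compatible_weak_top])
  fix \<phi> assume \<phi>: "\<phi> \<in> F"
  let ?P = "\<lambda>\<phi>. pullback_topology (carrier V) \<phi> (euclidean :: 'k topology)"
  have "continuous_map (sup_top (?P ` F)) (?P \<phi>) (\<lambda>x. x)"
    using \<phi> by (intro continuous_map_sup_top_id[where C = "carrier V"])
      (auto simp: topspace_pullback_topology)
  from continuous_map_compose[OF this continuous_map_pullback_self]
  show "continuous_map (weak_top V F) euclidean \<phi>" by (simp add: weak_top_def o_def)
qed

lemma has_dual_mackey_top: "has_dual V F (mackey_top V F)"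
proof (rule has_dualI[OF compatible_mackey_top])
  fix \<phi> assume \<phi>: "\<phi> \<in> F"
  have "continuous_map (mackey_top V F) (weak_top V F) (\<lambda>x. x)"
    unfolding mackey_top_def using compatible_weak_top
    by (intro continuous_map_sup_top_id[where C = "carrier V"]) (auto simp: compatible_def lctvsD(2))
  moreover have "continuous_map (weak_top V F) euclidean \<phi>"
    using has_dual_weak_top \<phi> by (auto simp: has_dual_def carrier_top_dual)
  ultimately show "continuous_map (mackey_top V F) euclidean \<phi>"
    using continuous_map_compose[of _ _ "\<lambda>x. x" _ \<phi>] by (simp add: o_def)
qed

lemma weak_top_weakest:
  assumes "has_dual V F T"
  shows "weaker_top (weak_top V F) T"
  unfolding weaker_top_def
  using assms openin_weak_top_mono[of T]
  by (auto simp: has_dual_def TVS_iff lctvsD(2) carrier_top_dual)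

lemma mackey_top_strongest:
  assumes "compatible V F T"
  shows "weaker_top T (mackey_top V F)"
  unfolding weaker_top_def mackey_top_def using assms by (auto intro: openin_sup_top)

end

section \<open>Continuity of morphisms of pairs\<close>

lemma continuous_map_weak_top:
  assumes 1: "dual_pair V F" and 2: "dual_pair W G" and A: "A \<in> linear_maps V W"
    and AG: "\<And>\<psi>. \<psi> \<in> G \<Longrightarrow> compose (carrier V) \<psi> A \<in> F"
  shows "continuous_map (weak_top V F) (weak_top W G) A"
  unfolding weak_top_def[of W]
proof (rule continuous_map_sup_topI)
  interpret V: dual_pair V F by (rule 1)
  interpret W: dual_pair W G by (rule 2)
  show "(\<lambda>\<phi>. pullback_topology (carrier W) \<phi> euclidean) ` G \<noteq> {}" using W.F_nonempty by simp
  fix T assume "T \<in> (\<lambda>\<phi>. pullback_topology (carrier W) \<phi> euclidean) ` G"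
  then obtain \<psi> where \<psi>: "\<psi> \<in> G" "T = pullback_topology (carrier W) \<psi> euclidean" by blast
  have top: "topspace (weak_top V F) = carrier V"
    using V.compatible_weak_top by (simp add: compatible_def lctvsD(2))
  have "continuous_map (weak_top V F) euclidean (compose (carrier V) \<psi> A)"
    using V.has_dual_weak_top AG[OF \<psi>(1)] by (auto simp: has_dual_def carrier_top_dual)
  then have "continuous_map (weak_top V F) euclidean (\<psi> \<circ> A)"
    by (rule continuous_map_eq) (simp add: top compose_def)
  then show "continuous_map (weak_top V F) T A"
    unfolding \<psi>(2) using linear_mapsD(1)[OF A] by (intro continuous_map_pullback') (auto simp: top)
qed

text \<open>The topology pulled back along \<open>A\<close> is compatible with \<open>F\<close>: its
  functionals are some \<open>\<psi>\<close> in \<open>G\<close> composed with \<open>A\<close>,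
  hence in \<open>F\<close> by \<open>AG\<close>. Being compatible, it is weaker than
  \<open>mackey_top V F\<close>, and this is continuity of \<open>A\<close>.\<close>

lemma continuous_map_mackey_top:
  assumes 1: "dual_pair V F" and 2: "dual_pair W G" and A: "A \<in> linear_maps V W"
    and AG: "\<And>\<psi>. \<psi> \<in> G \<Longrightarrow> compose (carrier V) \<psi> A \<in> F"
  shows "continuous_map (mackey_top V F) (mackey_top W G) A"
  unfolding continuous_map_def
proof (intro conjI allI impI)
  interpret V: dual_pair V F by (rule 1)
  interpret W: dual_pair W G by (rule 2)
  let ?P = "pullback_topology (carrier V) A (mackey_top W G)"
  have W: "lctvs W (mackey_top W G)" "carrier (top_dual (W, mackey_top W G)) \<subseteq> G"
    using W.compatible_mackey_top by (auto simp: compatible_def)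
  have top: "topspace (mackey_top V F) = carrier V"
    using V.compatible_mackey_top by (simp add: compatible_def lctvsD(2))
  show "A \<in> topspace (mackey_top V F) \<rightarrow> topspace (mackey_top W G)"
    using linear_mapsD(1)[OF A] by (simp add: top lctvsD(2)[OF W(1)])
  have "compatible V F ?P" unfolding compatible_def
  proof
    show "lctvs V ?P" by (rule V.lctvs_pullback[OF A W(1)])
    show "carrier (top_dual (V, ?P)) \<subseteq> F"
    proof
      fix \<phi> assume "\<phi> \<in> carrier (top_dual (V, ?P))"
      then show "\<phi> \<in> F" using V.top_dual_pullback[OF A W(1)] W(2) AG by blast
    qed
  qed
  from V.mackey_top_strongest[OF this]
  have mono: "\<And>U. openin ?P U \<Longrightarrow> openin (mackey_top V F) U" by (simp add: weaker_top_def)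
  fix U assume "openin (mackey_top W G) U"
  then have "openin ?P (A -` U \<inter> carrier V)" by (auto simp: openin_pullback_topology)
  moreover have "A -` U \<inter> carrier V = {x \<in> topspace (mackey_top V F). A x \<in> U}" by (auto simp: top)
  ultimately show "openin (mackey_top V F) {x \<in> topspace (mackey_top V F). A x \<in> U}" using mono by simp
qed

section \<open>Pairs, evaluations and double duals\<close>

lemma top_dual_sel [simp]:
  "add (top_dual (V, T)) = (\<lambda>\<phi> \<psi>. \<lambda>x\<in>carrier V. \<phi> x + \<psi> x)"
  "smult (top_dual (V, T)) = (\<lambda>c \<phi>. \<lambda>x\<in>carrier V. c * \<phi> x)"
  "zero (top_dual (V, T)) = (\<lambda>x\<in>carrier V. 0)"
  by (simp_all add: top_dual.simps alg_dual_def)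

section \<open>The dual space and separation of points\<close>

context kspace begin

lemma vec_space_top_dual:
  assumes T: "lctvs V T"
  shows "vec_space (top_dual (V, T))"
  unfolding vec_space_def
proof (rule moduleI)
  have add: "(\<lambda>x\<in>carrier V. \<phi> x + \<psi> x) \<in> carrier (top_dual (V, T))"
    if "\<phi> \<in> carrier (top_dual (V, T))" "\<psi> \<in> carrier (top_dual (V, T))" for \<phi> \<psi>
  proof -
    have \<phi>: "\<phi> \<in> linear_maps V scalar_module" "continuous_map T euclidean \<phi>"
      and \<psi>: "\<psi> \<in> linear_maps V scalar_module" "continuous_map T euclidean \<psi>"
      using that by (auto simp: carrier_top_dual)
    have "(\<lambda>x\<in>carrier V. \<phi> x + \<psi> x) \<in> linear_maps V scalar_module"
      by (rule linear_mapsI) (auto simp: linear_mapsD[OF \<phi>(1)] linear_mapsD[OF \<psi>(1)] algebra_simps)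
    moreover have "continuous_map T euclidean (\<lambda>x. \<phi> x + \<psi> x)"
      using \<phi>(2) \<psi>(2) by (rule continuous_map_add)
    then have "continuous_map T euclidean (\<lambda>x\<in>carrier V. \<phi> x + \<psi> x)"
      by (rule continuous_map_eq) (simp add: lctvsD(2)[OF T])
    ultimately show ?thesis by (simp add: carrier_top_dual)
  qed
  have smult: "(\<lambda>x\<in>carrier V. c * \<phi> x) \<in> carrier (top_dual (V, T))"
    if "\<phi> \<in> carrier (top_dual (V, T))" for c \<phi>
  proof -
    have \<phi>: "\<phi> \<in> linear_maps V scalar_module" "continuous_map T euclidean \<phi>"
      using that by (auto simp: carrier_top_dual)
    have "(\<lambda>x\<in>carrier V. c * \<phi> x) \<in> linear_maps V scalar_module"
      by (rule linear_mapsI) (auto simp: linear_mapsD[OF \<phi>(1)] algebra_simps)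
    moreover have "continuous_map T euclidean ((*) c \<circ> \<phi>)"
      using \<phi>(2) by (rule continuous_map_compose) (auto intro!: continuous_intros)
    then have "continuous_map T euclidean (\<lambda>x\<in>carrier V. c * \<phi> x)"
      by (rule continuous_map_eq) (simp add: lctvsD(2)[OF T])
    ultimately show ?thesis by (simp add: carrier_top_dual)
  qed
  have zero: "(\<lambda>x\<in>carrier V. 0) \<in> carrier (top_dual (V, T))"
  proof -
    have "(\<lambda>x\<in>carrier V. 0) \<in> linear_maps V scalar_module" by (rule linear_mapsI) auto
    moreover have "continuous_map T euclidean (\<lambda>x\<in>carrier V. (0 :: 'k))"
      by (rule continuous_map_eq[of _ _ "\<lambda>x. 0"]) (auto simp: lctvsD(2)[OF T])
    ultimately show ?thesis by (simp add: carrier_top_dual)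
  qed
  have ext: "\<phi> \<in> extensional (carrier V)" if "\<phi> \<in> carrier (top_dual (V, T))" for \<phi>
    using that linear_mapsD(4)[of \<phi>] by (auto simp: carrier_top_dual)
  have id: "(\<lambda>x\<in>carrier V. \<phi> x) = \<phi>" if "\<phi> \<in> carrier (top_dual (V, T))" for \<phi>
    using ext[OF that] by (rule extensional_restrict)
  show "abelian_group (top_dual (V, T))"
  proof (rule abelian_groupI)
    fix \<phi> assume \<phi>: "\<phi> \<in> carrier (top_dual (V, T))"
    show "\<exists>\<psi>\<in>carrier (top_dual (V, T)). \<psi> \<oplus>\<^bsub>top_dual (V, T)\<^esub> \<phi> = \<zero>\<^bsub>top_dual (V, T)\<^esub>"
      by (rule bexI[OF _ smult[OF \<phi>, of "-1"]]) (auto simp: restrict_def)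
    show "\<zero>\<^bsub>top_dual (V, T)\<^esub> \<oplus>\<^bsub>top_dual (V, T)\<^esub> \<phi> = \<phi>"
      using id[OF \<phi>] by (simp add: restrict_def cong: if_cong)
  qed (auto simp: add[unfolded restrict_def] zero[unfolded restrict_def] restrict_def algebra_simps)
  show "cring (ring_of_type_algebra :: 'k ring)" by (rule cring_from_type_algebra)
  fix \<phi> assume \<phi>: "\<phi> \<in> carrier (top_dual (V, T))"
  show "\<one>\<^bsub>ring_of_type_algebra\<^esub> \<odot>\<^bsub>top_dual (V, T)\<^esub> \<phi> = \<phi>"
    using id[OF \<phi>] by (simp add: ring_of_type_algebra_def)
  show "c \<odot>\<^bsub>top_dual (V, T)\<^esub> \<phi> \<in> carrier (top_dual (V, T))" for c
    using smult[OF \<phi>] by simp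
qed (auto simp: ring_of_type_algebra_def restrict_def algebra_simps)

text \<open>The line through \<open>z\<close> carries the functional \<open>t z \<mapsto> t\<close>; it is at most 1 on a convex
  neighbourhood of 0 that does not contain \<open>z\<close>.\<close>

lemma top_dual_separating:
  assumes T: "(V, T) \<in> TVS" and xy: "x \<in> carrier V" "y \<in> carrier V"
    and eq: "\<And>\<phi>. \<phi> \<in> carrier (top_dual (V, T)) \<Longrightarrow> \<phi> x = \<phi> y"
  shows "x = y"
proof (rule ccontr)
  assume "x \<noteq> y"
  have lc: "lctvs V T" and H: "Hausdorff_space T" using T by (auto simp: TVS_iff)
  define z where "z = x \<oplus> (of_real (-1) :: 'k) \<odot> y"
  have zC: "z \<in> carrier V" using xy unfolding z_def by blast
  have "z \<noteq> \<zero>"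
  proof
    assume "z = \<zero>"
    then have "x = of_real (-1) \<odot> (of_real (-1) \<odot> y)"
      using add_eq_zr[of x "of_real (-1) \<odot> y"] xy by (simp add: z_def)
    then show False using \<open>x \<noteq> y\<close> scl_scl[OF xy(2), of "-1" "-1"] xy by simp
  qed
  then obtain N where N: "openin T N" "\<zero> \<in> N" "z \<notin> N"
    using H zC zr_closed unfolding Hausdorff_space_def lctvsD(2)[OF lc] disjnt_iff by metis
  then obtain U where U: "convex_nhd V T U" "U \<subseteq> N" using ex_convex_nhd[OF lc] by blast
  have cU: "convex_subset U" "absorbing U"
    using U(1) absorbing_convex_nhd[OF lc] by (auto simp: convex_nhd_def convex_subset_iff)
  define G where "G = {((of_real t :: 'k) \<odot> z, t) | t. True}"
  have GI: "((of_real t :: 'k) \<odot> z, t) \<in> G" for t by (auto simp: G_def)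
  obtain f where f: "real_linear f" "\<And>u. u \<in> U \<Longrightarrow> f u \<le> 1" "\<And>u r. (u, r) \<in> G \<Longrightarrow> f u = r"
  proof (rule dominated_extension[OF cU])
    show "G \<subseteq> carrier V \<times> UNIV" using zC by (auto simp: G_def)
    show "(\<zero>, 0) \<in> G" using GI[of 0] zC by simp
    show "(u \<oplus> v, r + s) \<in> G" if "(u, r) \<in> G" "(v, s) \<in> G" for u r v s
      using that GI[of "r + s"] scl_add_left[OF zC, of r s] by (auto simp: G_def)
    show "(of_real t \<odot> u, t * r) \<in> G" if "(u, r) \<in> G" for u r t
      using that GI[of "t * r"] scl_scl[OF zC, of t r] by (auto simp: G_def)
    show "r \<le> 1" if "(u, r) \<in> G" "u \<in> U" for u r
    proof (rule ccontr)
      assume r: "\<not> r \<le> 1"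
      have u: "u = of_real r \<odot> z" using that by (auto simp: G_def)
      \<comment> \<open>For \<open>r > 1\<close>, shrinking \<open>u\<close> by \<open>1/r\<close>
        stays in \<open>U\<close> by convexity with zero and produces \<open>z\<close>, which
        \<open>N\<close> omits.\<close>
      have "of_real (1/r) \<odot> u \<in> U"
        using convex_subset_scl[OF cU(1) absorbing_zr[OF cU(2)] that(2), of "1/r"] r by simp
      moreover have "of_real (1/r) \<odot> u = z" using scl_scl[OF zC, of "1/r" r] r zC u by simp
      ultimately show False using N U(2) by blast
    qed
  qed blast
  obtain \<phi> where \<phi>: "\<phi> \<in> carrier (top_dual (V, T))" "\<And>x. x \<in> carrier V \<Longrightarrow> re_part (\<phi> x) = f x"
    using dominated_functional[OF lc f(1) U(1) f(2)] by blast
  have "f z = 1" using f(3)[OF GI[of 1]] zC by simp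
  moreover have "f z = f x + (-1) * f y"
    using xy real_linearD(1)[OF f(1), of x "of_real (-1) \<odot> y"] real_linearD(2)[OF f(1), of y "-1"]
    by (simp add: z_def)
  moreover have "f x = f y" using eq[OF \<phi>(1)] \<phi>(2) xy by metis
  ultimately show False by simp
qed

end

text \<open>The image of the second space in the algebraic dual of the first. For a pair in
  \<open>CHU\<close> the dual topologies depend on the second space through this set alone, by
  \<open>dual_topology_iff\<close>.\<close>

definition functionals :: "('k::real_or_complex, 'a, 'b) chu \<Rightarrow> ('a \<Rightarrow> 'k) set" where
  "functionals P = (\<lambda>w. \<lambda>v\<in>carrier (fst P). snd (snd P) v w) ` carrier (fst (snd P))"

lemma functionals_eq: "functionals (V, W, p) = (\<lambda>w. \<lambda>v\<in>carrier V. p v w) ` carrier W"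
  by (simp add: functionals_def)

lemma CHU_pairing:
  assumes "(V, W, p) \<in> CHU" "v \<in> carrier V" "w \<in> carrier W"
  shows "u \<in> carrier V \<Longrightarrow> p (u \<oplus>\<^bsub>V\<^esub> v) w = p u w + p v w" "p (c \<odot>\<^bsub>V\<^esub> v) w = c * p v w"
    "u' \<in> carrier W \<Longrightarrow> p v (u' \<oplus>\<^bsub>W\<^esub> w) = p v u' + p v w" "p v (c \<odot>\<^bsub>W\<^esub> w) = c * p v w"
proof -
  have VW: "kspace V" "kspace W" using assms(1) by (auto simp: CHU_def kspace_def)
  interpret V: kspace V by (rule VW)
  interpret W: kspace W by (rule VW)
  have 1: "(\<lambda>v\<in>carrier V. p v w) \<in> linear_maps V scalar_module"
    and 2: "(\<lambda>w\<in>carrier W. p v w) \<in> linear_maps W scalar_module"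
    using assms by (auto simp: CHU_def carrier_alg_dual)
  show "p (u \<oplus>\<^bsub>V\<^esub> v) w = p u w + p v w" if "u \<in> carrier V"
    using linear_mapsD(2)[OF 1 that assms(2)] that assms by simp
  show "p (c \<odot>\<^bsub>V\<^esub> v) w = c * p v w" using linear_mapsD(3)[OF 1 assms(2), of c] assms by simp
  show "p v (u' \<oplus>\<^bsub>W\<^esub> w) = p v u' + p v w" if "u' \<in> carrier W"
    using linear_mapsD(2)[OF 2 that assms(3)] that assms by simp
  show "p v (c \<odot>\<^bsub>W\<^esub> w) = c * p v w" using linear_mapsD(3)[OF 2 assms(3), of c] assms by simp
qed

lemma dual_pair_functionals:
  assumes P: "(V, W, p) \<in> CHU"
  shows "dual_pair V (functionals (V, W, p))"
proof -
  have VW: "kspace V" "kspace W" using assms by (auto simp: CHU_def kspace_def)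
  interpret V: kspace V by (rule VW)
  interpret W: kspace W by (rule VW)
  note p = CHU_pairing[OF P]
  have I: "(\<lambda>v\<in>carrier V. p v w) \<in> functionals (V, W, p)" if "w \<in> carrier W" for w
    using that by (auto simp: functionals_eq)
  show ?thesis
  proof unfold_locales
    show "functionals (V, W, p) \<subseteq> linear_maps V scalar_module"
      using P by (auto simp: functionals_eq CHU_def carrier_alg_dual)
    show "functionals (V, W, p) \<noteq> {}" using W.zr_closed by (auto simp: functionals_eq)
    show "(\<lambda>x\<in>carrier V. \<phi> x + \<psi> x) \<in> functionals (V, W, p)"
      if "\<phi> \<in> functionals (V, W, p)" "\<psi> \<in> functionals (V, W, p)" for \<phi> \<psi>
    proof -
      from that obtain w u where w: "w \<in> carrier W" "u \<in> carrier W" "\<phi> = (\<lambda>v\<in>carrier V. p v w)"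
        "\<psi> = (\<lambda>v\<in>carrier V. p v u)" by (auto simp: functionals_eq)
      then have "(\<lambda>x\<in>carrier V. \<phi> x + \<psi> x) = (\<lambda>v\<in>carrier V. p v (w \<oplus>\<^bsub>W\<^esub> u))"
        by (intro restrict_ext) (simp add: p)
      then show ?thesis using I[of "w \<oplus>\<^bsub>W\<^esub> u"] w by simp
    qed
    show "(\<lambda>x\<in>carrier V. c * \<phi> x) \<in> functionals (V, W, p)" if "\<phi> \<in> functionals (V, W, p)" for c \<phi>
    proof -
      from that obtain w where w: "w \<in> carrier W" "\<phi> = (\<lambda>v\<in>carrier V. p v w)"
        by (auto simp: functionals_eq)
      then have "(\<lambda>x\<in>carrier V. c * \<phi> x) = (\<lambda>v\<in>carrier V. p v (c \<odot>\<^bsub>W\<^esub> w))"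
        by (intro restrict_ext) (simp add: p)
      then show ?thesis using I[of "c \<odot>\<^bsub>W\<^esub> w"] w by simp
    qed
    show "x = y" if xy: "x \<in> carrier V" "y \<in> carrier V"
      and eq: "\<And>\<phi>. \<phi> \<in> functionals (V, W, p) \<Longrightarrow> \<phi> x = \<phi> y" for x y
    proof -
      have "p x w = p y w" if "w \<in> carrier W" for w using eq[OF I[OF that]] xy by simp
      then have "(\<lambda>w\<in>carrier W. p x w) = (\<lambda>w\<in>carrier W. p y w)" by (rule restrict_ext)
      moreover have "inj_on (\<lambda>v. \<lambda>w\<in>carrier W. p v w) (carrier V)" using P by (simp add: CHU_def)
      ultimately show ?thesis using xy by (simp add: inj_on_def)
    qed
  qed
qed

text \<open>Linearity and injectivity of the map from \<open>W\<close> hold in every pair, so being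
  an isomorphism onto the dual amounts to having the dual as its range.\<close>

lemma dual_topology_iff:
  assumes P: "(V, W, p) \<in> CHU"
  shows "dual_topology (V, W, p) T \<longleftrightarrow> has_dual V (functionals (V, W, p)) T"
proof
  assume "dual_topology (V, W, p) T"
  then show "has_dual V (functionals (V, W, p)) T"
    by (simp add: has_dual_def functionals_eq bij_betw_def)
next
  assume h: "has_dual V (functionals (V, W, p)) T"
  have VW: "kspace V" "kspace W" using assms by (auto simp: CHU_def kspace_def)
  interpret V: kspace V by (rule VW)
  interpret W: kspace W by (rule VW)
  note p = CHU_pairing[OF P]
  have I: "(\<lambda>v\<in>carrier V. p v w) \<in> carrier (top_dual (V, T))" if "w \<in> carrier W" for w
    using that h by (auto simp: functionals_eq has_dual_def)
  have "inj_on (\<lambda>w. \<lambda>v\<in>carrier V. p v w) (carrier W)" using P by (simp add: CHU_def)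
  then have "bij_betw (\<lambda>w. \<lambda>v\<in>carrier V. p v w) (carrier W) (carrier (top_dual (V, T)))"
    using h by (simp add: has_dual_def functionals_eq bij_betw_def)
  moreover have "(\<lambda>w\<in>carrier W. \<lambda>v\<in>carrier V. p v w) \<in> linear_maps W (top_dual (V, T))"
    by (rule linear_mapsI) (auto simp: I p intro!: restrict_ext)
  ultimately show "dual_topology (V, W, p) T" using P h by (simp add: has_dual_def)
qed

lemma weaker_top_antisym: "weaker_top S T \<Longrightarrow> weaker_top T S \<Longrightarrow> S = T"
  unfolding weaker_top_def topology_eq by blast

text \<open>\<open>weak_top\<close> has the defining property, and \<open>weaker_top_antisym\<close>
  makes the definite description unique.\<close>

lemma sigma_top_eq:
  assumes P: "(V, W, p) \<in> CHU"
  shows "sigma_top (V, W, p) = weak_top V (functionals (V, W, p))"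
proof -
  interpret dual_pair V "functionals (V, W, p)" by (rule dual_pair_functionals[OF P])
  show ?thesis unfolding sigma_top_def dual_topology_iff[OF P]
    using has_dual_weak_top weak_top_weakest by (intro the_equality) (auto intro: weaker_top_antisym)
qed

lemma tau_top_eq:
  assumes P: "(V, W, p) \<in> CHU"
  shows "tau_top (V, W, p) = mackey_top V (functionals (V, W, p))"
proof -
  interpret dual_pair V "functionals (V, W, p)" by (rule dual_pair_functionals[OF P])
  have "weaker_top S (mackey_top V (functionals (V, W, p)))" if "has_dual V (functionals (V, W, p)) S" for S
    using that by (intro mackey_top_strongest) (auto simp: has_dual_def compatible_def TVS_iff)
  then show ?thesis unfolding tau_top_def dual_topology_iff[OF P]
    using has_dual_mackey_top by (intro the_equality) (auto intro: weaker_top_antisym)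
qed

lemma CHU_chu_dual: "P \<in> CHU \<Longrightarrow> chu_dual P \<in> CHU"
  by (cases P) (auto simp: CHU_def)

text \<open>The substantial axiom is injectivity of evaluation on \<open>V\<close>, that is,
  \<open>top_dual_separating\<close>; the Hausdorff condition enters there.\<close>

lemma T_chu_CHU:
  assumes T: "(V, T) \<in> TVS"
  shows "T_chu (V, T) \<in> CHU"
proof -
  have lc: "lctvs V T" using T by (simp add: TVS_iff)
  interpret kspace V by unfold_locales (rule lctvsD(1)[OF lc])
  have ext: "(\<lambda>v\<in>carrier V. \<phi> v) = \<phi>" if "\<phi> \<in> carrier (top_dual (V, T))" for \<phi>
    using that linear_mapsD(4)[of \<phi>] by (auto simp: carrier_top_dual intro: extensional_restrict)
  have vs: "vec_space (top_dual (V, T))" by (rule vec_space_top_dual[OF lc])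
  interpret N: kspace "top_dual (V, T)" by unfold_locales (rule vs)
  have ev: "(\<lambda>\<phi>\<in>carrier (top_dual (V, T)). \<phi> v) \<in> linear_maps (top_dual (V, T)) scalar_module"
    if "v \<in> carrier V" for v
  proof (rule linear_mapsI)
    fix \<phi> \<psi> assume "\<phi> \<in> carrier (top_dual (V, T))" "\<psi> \<in> carrier (top_dual (V, T))"
    then show "(\<lambda>\<phi>\<in>carrier (top_dual (V, T)). \<phi> v) (\<phi> \<oplus>\<^bsub>top_dual (V, T)\<^esub> \<psi>) =
        (\<lambda>\<phi>\<in>carrier (top_dual (V, T)). \<phi> v) \<phi> \<oplus>\<^bsub>scalar_module\<^esub> (\<lambda>\<phi>\<in>carrier (top_dual (V, T)). \<phi> v) \<psi>"
      using N.add_closed[of \<phi> \<psi>] that by simp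
  next
    fix c \<phi> assume "\<phi> \<in> carrier (top_dual (V, T))"
    then show "(\<lambda>\<phi>\<in>carrier (top_dual (V, T)). \<phi> v) (c \<odot>\<^bsub>top_dual (V, T)\<^esub> \<phi>) =
        c \<odot>\<^bsub>scalar_module\<^esub> (\<lambda>\<phi>\<in>carrier (top_dual (V, T)). \<phi> v) \<phi>"
      using N.smult_closed[of \<phi> c] that by simp
  qed auto
  have inj1: "inj_on (\<lambda>v. \<lambda>\<phi>\<in>carrier (top_dual (V, T)). \<phi> v) (carrier V)"
  proof (rule inj_onI)
    fix x y assume xy: "x \<in> carrier V" "y \<in> carrier V"
      and eq: "(\<lambda>\<phi>\<in>carrier (top_dual (V, T)). \<phi> x) = (\<lambda>\<phi>\<in>carrier (top_dual (V, T)). \<phi> y)"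
    show "x = y"
    proof (rule top_dual_separating[OF T xy])
      fix \<phi> assume "\<phi> \<in> carrier (top_dual (V, T))"
      then show "\<phi> x = \<phi> y" using fun_cong[OF eq, of \<phi>] by simp
    qed
  qed
  have inj2: "inj_on (\<lambda>\<phi>. \<lambda>v\<in>carrier V. \<phi> v) (carrier (top_dual (V, T)))"
    using ext by (simp add: inj_on_def)
  show ?thesis
    using vec_space vs ev inj1 inj2 ext unfolding T_chu_def CHU_def
    by (simp add: carrier_alg_dual) (simp add: carrier_top_dual)
qed

lemma functionals_T_chu: "functionals (T_chu (V, T)) = carrier (top_dual (V, T))"
proof -
  have "(\<lambda>v\<in>carrier V. \<phi> v) = \<phi>" if "\<phi> \<in> carrier (top_dual (V, T))" for \<phi>
    using that linear_mapsD(4)[of \<phi>] by (auto simp: carrier_top_dual intro: extensional_restrict)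
  then show ?thesis by (simp add: functionals_def T_chu_def)
qed

lemma dual_pair_top_dual:
  "(V, T) \<in> TVS \<Longrightarrow> dual_pair V (carrier (top_dual (V, T)))"
  using dual_pair_functionals[of V "top_dual (V, T)" "\<lambda>v \<phi>. \<phi> v"] T_chu_CHU[of V T]
    functionals_T_chu[of V T] by (simp add: T_chu_def)

lemma TVS_w_iff: "(V, T) \<in> TVS_w \<longleftrightarrow> (V, T) \<in> TVS \<and> T = weak_top V (carrier (top_dual (V, T)))"
  using sigma_top_eq[of V "top_dual (V, T)" "\<lambda>v \<phi>. \<phi> v"] T_chu_CHU[of V T] functionals_T_chu[of V T]
  by (auto simp: TVS_w_def T_chu_def)

lemma TVS_m_iff: "(V, T) \<in> TVS_m \<longleftrightarrow> (V, T) \<in> TVS \<and> T = mackey_top V (carrier (top_dual (V, T)))"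
  using tau_top_eq[of V "top_dual (V, T)" "\<lambda>v \<phi>. \<phi> v"] T_chu_CHU[of V T] functionals_T_chu[of V T]
  by (auto simp: TVS_m_def T_chu_def)

section \<open>The two dualities on objects\<close>

definition evaluations :: "('k::real_or_complex, 'a) tvs \<Rightarrow> (('a \<Rightarrow> 'k) \<Rightarrow> 'k) set" where
  "evaluations V = (\<lambda>v. \<lambda>\<phi>\<in>carrier (top_dual V). \<phi> v) ` carrier (fst V)"

text \<open>One second dual for \<open>D_w\<close> and \<open>D_m\<close> alike: by
  \<open>D_w_TVS\<close> and \<open>D_m_TVS\<close> the continuous functionals are exactly the
  evaluations. The other fields come from \<open>alg_dual\<close>, so that this is an equality of
  records.\<close>

definition bidual :: "('k::real_or_complex, 'a) tvs \<Rightarrow> ('k, ('a \<Rightarrow> 'k) \<Rightarrow> 'k) module" where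
  "bidual V = (alg_dual (top_dual V))\<lparr>carrier := evaluations V\<rparr>"

lemma bidual_sel [simp]:
  "carrier (bidual V) = evaluations V"
  "add (bidual V) = (\<lambda>\<phi> \<psi>. \<lambda>x\<in>carrier (top_dual V). \<phi> x + \<psi> x)"
  "smult (bidual V) = (\<lambda>c \<phi>. \<lambda>x\<in>carrier (top_dual V). c * \<phi> x)"
  by (simp_all add: bidual_def alg_dual_def)

lemma evaluations_eq: "evaluations V = functionals (chu_dual (T_chu V))"
  by (simp add: evaluations_def T_chu_def functionals_eq)

lemma dual_pair_evaluations:
  assumes "V \<in> TVS"
  shows "dual_pair (top_dual V) (evaluations V)"
  using dual_pair_functionals[of "top_dual V" "fst V" "\<lambda>\<phi> v. \<phi> v"]
    CHU_chu_dual[OF T_chu_CHU[of "fst V" "snd V"]] assms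
  by (simp add: evaluations_eq T_chu_def)

lemma D_w_eq: "V \<in> TVS \<Longrightarrow> D_w V = (top_dual V, weak_top (top_dual V) (evaluations V))"
  using sigma_top_eq[of "top_dual V" "fst V" "\<lambda>\<phi> v. \<phi> v"] CHU_chu_dual[OF T_chu_CHU[of "fst V" "snd V"]]
  by (simp add: evaluations_eq T_chu_def D_w_def R_chu_def)

lemma D_m_eq: "V \<in> TVS \<Longrightarrow> D_m V = (top_dual V, mackey_top (top_dual V) (evaluations V))"
  using tau_top_eq[of "top_dual V" "fst V" "\<lambda>\<phi> v. \<phi> v"] CHU_chu_dual[OF T_chu_CHU[of "fst V" "snd V"]]
  by (simp add: evaluations_eq T_chu_def D_m_def L_chu_def)

text \<open>The weak topology defined by \<open>evaluations V\<close> has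
  \<open>evaluations V\<close> as its dual, so it is the weak topology for its own dual.\<close>

lemma D_w_TVS:
  assumes V: "V \<in> TVS"
  shows "D_w V \<in> TVS" "D_w V \<in> TVS_w" "fst (D_w V) = top_dual V" "top_dual (D_w V) = bidual V"
proof -
  interpret dual_pair "top_dual V" "evaluations V" by (rule dual_pair_evaluations[OF V])
  have h: "has_dual (top_dual V) (evaluations V) (weak_top (top_dual V) (evaluations V))"
    by (rule has_dual_weak_top)
  then show "D_w V \<in> TVS" "D_w V \<in> TVS_w" "fst (D_w V) = top_dual V" "top_dual (D_w V) = bidual V"
    using D_w_eq[OF V] by (simp_all add: has_dual_def TVS_w_iff)
      (simp add: top_dual.simps bidual_def)
qed

lemma D_m_TVS:
  assumes V: "V \<in> TVS"
  shows "D_m V \<in> TVS" "D_m V \<in> TVS_m" "fst (D_m V) = top_dual V" "top_dual (D_m V) = bidual V"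
proof -
  interpret dual_pair "top_dual V" "evaluations V" by (rule dual_pair_evaluations[OF V])
  have h: "has_dual (top_dual V) (evaluations V) (mackey_top (top_dual V) (evaluations V))"
    by (rule has_dual_mackey_top)
  then show "D_m V \<in> TVS" "D_m V \<in> TVS_m" "fst (D_m V) = top_dual V" "top_dual (D_m V) = bidual V"
    using D_m_eq[OF V] by (simp_all add: has_dual_def TVS_m_iff)
      (simp add: top_dual.simps bidual_def)
qed

section \<open>Transposes and naturality of evaluation\<close>

lemma tvs_hom_iff:
  "f \<in> tvs_hom V W \<longleftrightarrow> f \<in> linear_maps (fst V) (fst W) \<and> continuous_map (snd V) (snd W) f"
  by (cases V; cases W) auto

lemma top_dual_iff:
  "\<phi> \<in> carrier (top_dual V) \<longleftrightarrow>
    \<phi> \<in> linear_maps (fst V) scalar_module \<and> continuous_map (snd V) euclidean \<phi>"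
  by (cases V) (simp add: carrier_top_dual)

lemma TVS_topspace: "V \<in> TVS \<Longrightarrow> topspace (snd V) = carrier (fst V)"
  by (cases V) (simp add: TVS_iff lctvsD(2))

lemma top_dual_extensional: "\<phi> \<in> carrier (top_dual V) \<Longrightarrow> \<phi> \<in> extensional (carrier (fst V))"
  using linear_mapsD(4)[of \<phi>] by (auto simp: top_dual_iff)

lemma top_dual_ops [simp]:
  "add (top_dual V) = (\<lambda>\<phi> \<psi>. \<lambda>x\<in>carrier (fst V). \<phi> x + \<psi> x)"
  "smult (top_dual V) = (\<lambda>c \<phi>. \<lambda>x\<in>carrier (fst V). c * \<phi> x)"
  by (cases V; simp)+

lemma comp_top_dual:
  assumes V: "V \<in> TVS" and f: "f \<in> tvs_hom V W" and \<phi>: "\<phi> \<in> carrier (top_dual W)"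
  shows "tvs_comp V \<phi> f \<in> carrier (top_dual V)"
proof -
  have f': "f \<in> linear_maps (fst V) (fst W)" "continuous_map (snd V) (snd W) f"
    using f by (auto simp: tvs_hom_iff)
  have \<phi>': "\<phi> \<in> linear_maps (fst W) scalar_module" "continuous_map (snd W) euclidean \<phi>"
    using \<phi> by (auto simp: top_dual_iff)
  have vs: "kspace (fst V)" using V by (cases V) (auto simp: TVS_iff kspace_def lctvsD(1))
  have "tvs_comp V \<phi> f \<in> linear_maps (fst V) scalar_module"
  proof (rule linear_mapsI)
    interpret kspace "fst V" by (rule vs)
    show "tvs_comp V \<phi> f (x \<oplus>\<^bsub>fst V\<^esub> y) = tvs_comp V \<phi> f x \<oplus>\<^bsub>scalar_module\<^esub> tvs_comp V \<phi> f y"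
      if "x \<in> carrier (fst V)" "y \<in> carrier (fst V)" for x y
      using that by (simp add: tvs_comp_def compose_def linear_mapsD[OF f'(1)] linear_mapsD[OF \<phi>'(1)])
    show "tvs_comp V \<phi> f (c \<odot>\<^bsub>fst V\<^esub> x) = c \<odot>\<^bsub>scalar_module\<^esub> tvs_comp V \<phi> f x"
      if "x \<in> carrier (fst V)" for c x
      using that by (simp add: tvs_comp_def compose_def linear_mapsD[OF f'(1)] linear_mapsD[OF \<phi>'(1)])
  qed (auto simp: tvs_comp_def)
  moreover have "continuous_map (snd V) euclidean (\<phi> \<circ> f)"
    using f'(2) \<phi>'(2) by (rule continuous_map_compose)
  then have "continuous_map (snd V) euclidean (tvs_comp V \<phi> f)"
    by (rule continuous_map_eq) (simp add: TVS_topspace[OF V] tvs_comp_def compose_def)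
  ultimately show ?thesis by (simp add: top_dual_iff)
qed

lemma transpose_map_linear:
  assumes V: "V \<in> TVS" and W: "W \<in> TVS" and f: "f \<in> tvs_hom V W"
  shows "transpose_map V W f \<in> linear_maps (top_dual W) (top_dual V)"
proof (rule linear_mapsI)
  interpret N: dual_pair "top_dual W" "evaluations W" by (rule dual_pair_evaluations[OF W])
  have f': "f \<in> linear_maps (fst V) (fst W)" using f by (simp add: tvs_hom_iff)
  show "transpose_map V W f \<phi> \<in> carrier (top_dual V)" if "\<phi> \<in> carrier (top_dual W)" for \<phi>
    using comp_top_dual[OF V f that] that by (simp add: transpose_map_def)
  show "transpose_map V W f (\<phi> \<oplus>\<^bsub>top_dual W\<^esub> \<psi>) =
      transpose_map V W f \<phi> \<oplus>\<^bsub>top_dual V\<^esub> transpose_map V W f \<psi>"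
    if "\<phi> \<in> carrier (top_dual W)" "\<psi> \<in> carrier (top_dual W)" for \<phi> \<psi>
    using that N.add_closed[OF that] linear_mapsD(1)[OF f']
    by (auto simp: transpose_map_def tvs_comp_def compose_def intro!: restrict_ext)
  show "transpose_map V W f (c \<odot>\<^bsub>top_dual W\<^esub> \<phi>) = c \<odot>\<^bsub>top_dual V\<^esub> transpose_map V W f \<phi>"
    if "\<phi> \<in> carrier (top_dual W)" for c \<phi>
    using that N.smult_closed[OF that, of c] linear_mapsD(1)[OF f']
    by (auto simp: transpose_map_def tvs_comp_def compose_def intro!: restrict_ext)
qed (simp add: transpose_map_def)

text \<open>Both sides send \<open>\<phi>\<close> to \<open>\<phi> (f x)\<close>. The identity
  serves twice, for continuity of the transpose and for naturality.\<close>

lemma evaluation_transpose_map: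
  assumes V: "V \<in> TVS" and f: "f \<in> tvs_hom V W" and x: "x \<in> carrier (fst V)"
  shows "compose (carrier (top_dual W)) (double_dual_eval V x) (transpose_map V W f) =
    double_dual_eval W (f x)"
proof -
  have "f x \<in> carrier (fst W)" using f x linear_mapsD(1)[of f] by (auto simp: tvs_hom_iff)
  then show ?thesis
    using comp_top_dual[OF V f] x
    by (auto simp: compose_def double_dual_eval_def transpose_map_def tvs_comp_def intro!: restrict_ext)
qed

lemma evaluations_transpose_map:
  assumes V: "V \<in> TVS" and f: "f \<in> tvs_hom V W" and e: "e \<in> evaluations V"
  shows "compose (carrier (top_dual W)) e (transpose_map V W f) \<in> evaluations W"
proof -
  obtain x where x: "x \<in> carrier (fst V)" "e = double_dual_eval V x"
    using e by (auto simp: evaluations_def double_dual_eval_def)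
  have "f x \<in> carrier (fst W)" using f x linear_mapsD(1)[of f] by (auto simp: tvs_hom_iff)
  then have "double_dual_eval W (f x) \<in> evaluations W"
    by (simp add: evaluations_def double_dual_eval_def)
  then show ?thesis using evaluation_transpose_map[OF V f x(1)] x(2) by simp
qed

lemma transpose_map_D_w:
  assumes "V \<in> TVS" "W \<in> TVS" "f \<in> tvs_hom V W"
  shows "transpose_map V W f \<in> tvs_hom (D_w W) (D_w V)"
  using assms transpose_map_linear[OF assms]
    continuous_map_weak_top[OF dual_pair_evaluations[OF assms(2)] dual_pair_evaluations[OF assms(1)]
      transpose_map_linear[OF assms] evaluations_transpose_map[OF assms(1,3)]]
  by (simp add: tvs_hom_iff D_w_eq)

lemma transpose_map_D_m:
  assumes "V \<in> TVS" "W \<in> TVS" "f \<in> tvs_hom V W"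
  shows "transpose_map V W f \<in> tvs_hom (D_m W) (D_m V)"
  using assms transpose_map_linear[OF assms]
    continuous_map_mackey_top[OF dual_pair_evaluations[OF assms(2)] dual_pair_evaluations[OF assms(1)]
      transpose_map_linear[OF assms] evaluations_transpose_map[OF assms(1,3)]]
  by (simp add: tvs_hom_iff D_m_eq)

lemma transpose_map_id: "transpose_map V V (tvs_id V) = (\<lambda>\<phi>\<in>carrier (top_dual V). \<phi>)"
  unfolding transpose_map_def
proof (rule restrict_ext)
  fix \<phi> assume "\<phi> \<in> carrier (top_dual V)"
  then have "(\<lambda>x\<in>carrier (fst V). \<phi> x) = \<phi>"
    by (intro extensional_restrict top_dual_extensional)
  then show "tvs_comp V \<phi> (tvs_id V) = \<phi>"
    by (simp add: tvs_comp_def tvs_id_def compose_def cong: restrict_cong)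
qed

lemma transpose_map_comp:
  assumes U: "U \<in> TVS" and V: "V \<in> TVS" and f: "f \<in> tvs_hom U V" and g: "g \<in> tvs_hom V W"
  shows "transpose_map U W (tvs_comp U g f) =
    compose (carrier (top_dual W)) (transpose_map U V f) (transpose_map V W g)"
proof -
  have "f x \<in> carrier (fst V)" if "x \<in> carrier (fst U)" for x
    using f that linear_mapsD(1)[of f] by (auto simp: tvs_hom_iff)
  then show ?thesis using comp_top_dual[OF V g]
    by (auto simp: transpose_map_def compose_def tvs_comp_def intro!: restrict_ext)
qed

text \<open>\<open>D\<close> and \<open>E\<close> stand for the duals of \<open>W\<close> and
  \<open>V\<close>. Only the module of \<open>D\<close> and the functionals on \<open>E\<close>
  matter, so the weak and the Mackey case share the argument.\<close>

lemma double_dual_eval_natural: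
  assumes V: "V \<in> TVS" and f: "f \<in> tvs_hom V W"
    and D: "fst D = top_dual W" "carrier (top_dual E) = evaluations V"
  shows "tvs_comp V (transpose_map D E (transpose_map V W f)) (double_dual_eval V) =
    tvs_comp V (double_dual_eval W) f"
  unfolding tvs_comp_def compose_def
proof (rule restrict_ext)
  fix x assume x: "x \<in> carrier (fst V)"
  then have "double_dual_eval V x \<in> carrier (top_dual E)"
    by (simp add: D evaluations_def double_dual_eval_def)
  then show "transpose_map D E (transpose_map V W f) (double_dual_eval V x) = double_dual_eval W (f x)"
    using evaluation_transpose_map[OF V f x]
    by (simp add: transpose_map_def[of D] tvs_comp_def D)
qed

section \<open>The evaluation isomorphism\<close>

lemma linear_maps_inverse:
  assumes V: "kspace V" and A: "A \<in> linear_maps V W" and bij: "bij_betw A (carrier V) (carrier W)"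
  obtains B where "B \<in> linear_maps W V" "\<And>x. x \<in> carrier V \<Longrightarrow> B (A x) = x"
    "\<And>y. y \<in> carrier W \<Longrightarrow> A (B y) = y"
proof -
  interpret kspace V by (rule V)
  note A' = linear_mapsD[OF A]
  define B where "B = restrict (the_inv_into (carrier V) A) (carrier W)"
  have inj: "inj_on A (carrier V)" and surj: "A ` carrier V = carrier W"
    using bij by (auto simp: bij_betw_def)
  have BA: "B (A x) = x" if "x \<in> carrier V" for x
    using that A'(1)[OF that] by (simp add: B_def the_inv_into_f_f[OF inj])
  have AB: "A (B y) = y" if "y \<in> carrier W" for y
    using that surj BA by (metis imageE)
  have BC: "B y \<in> carrier V" if "y \<in> carrier W" for y
    using that surj BA by (metis imageE)
  have "B \<in> linear_maps W V"
  proof (rule linear_mapsI[OF BC])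
    show "B (y \<oplus>\<^bsub>W\<^esub> z) = B y \<oplus>\<^bsub>V\<^esub> B z" if "y \<in> carrier W" "z \<in> carrier W" for y z
      using A'(2)[OF BC[OF that(1)] BC[OF that(2)]] BA[of "B y \<oplus>\<^bsub>V\<^esub> B z"] BC that AB by simp
    show "B (c \<odot>\<^bsub>W\<^esub> y) = c \<odot>\<^bsub>V\<^esub> B y" if "y \<in> carrier W" for c y
      using A'(3)[OF BC[OF that], of c] BA[of "c \<odot>\<^bsub>V\<^esub> B y"] BC that AB by simp
    show "B \<in> extensional (carrier W)" by (simp add: B_def)
  qed
  then show ?thesis using that BA AB by blast
qed

lemma double_dual_eval_linear:
  assumes V: "V \<in> TVS"
  shows "double_dual_eval V \<in> linear_maps (fst V) (bidual V)"
proof -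
  have "kspace (fst V)" using V by (cases V) (auto simp: TVS_iff kspace_def lctvsD(1))
  then interpret kspace "fst V" .
  show ?thesis
  proof (rule linear_mapsI)
    show "double_dual_eval V x \<in> carrier (bidual V)" if "x \<in> carrier (fst V)" for x
      using that by (simp add: double_dual_eval_def evaluations_def)
    show "double_dual_eval V (x \<oplus>\<^bsub>fst V\<^esub> y) = double_dual_eval V x \<oplus>\<^bsub>bidual V\<^esub> double_dual_eval V y"
      if "x \<in> carrier (fst V)" "y \<in> carrier (fst V)" for x y
      using that linear_mapsD(2)[of _ "fst V" scalar_module x y]
      by (auto simp: double_dual_eval_def top_dual_iff intro!: restrict_ext)
    show "double_dual_eval V (c \<odot>\<^bsub>fst V\<^esub> x) = c \<odot>\<^bsub>bidual V\<^esub> double_dual_eval V x"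
      if "x \<in> carrier (fst V)" for c x
      using that linear_mapsD(3)[of _ "fst V" scalar_module x c]
      by (auto simp: double_dual_eval_def top_dual_iff intro!: restrict_ext)
  qed (simp add: double_dual_eval_def)
qed

text \<open>Surjectivity holds by construction of \<open>bidual\<close>; injectivity is separation
  of points by the dual.\<close>

lemma double_dual_eval_bij:
  assumes V: "V \<in> TVS"
  shows "bij_betw (double_dual_eval V) (carrier (fst V)) (carrier (bidual V))"
  unfolding bij_betw_def
proof
  show "inj_on (double_dual_eval V) (carrier (fst V))"
  proof (rule inj_onI)
    fix x y assume xy: "x \<in> carrier (fst V)" "y \<in> carrier (fst V)"
      and eq: "double_dual_eval V x = double_dual_eval V y"
    interpret dual_pair "fst V" "carrier (top_dual V)"
      using dual_pair_top_dual[of "fst V" "snd V"] V by simp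
    show "x = y"
    proof (rule F_separating[OF xy])
      fix \<phi> assume "\<phi> \<in> carrier (top_dual V)"
      then show "\<phi> x = \<phi> y" using fun_cong[OF eq, of \<phi>] xy by (simp add: double_dual_eval_def)
    qed
  qed
  show "double_dual_eval V ` carrier (fst V) = carrier (bidual V)"
    by (auto simp: double_dual_eval_def evaluations_def)
qed

text \<open>Both directions of the evaluation map are continuous because it matches the functionals of
  \<open>V\<close> with the evaluations on the bidual.\<close>

lemma double_dual_eval_iso:
  assumes V: "V \<in> TVS"
    and hom: "\<And>A. A \<in> linear_maps (fst V) (bidual V) \<Longrightarrow>
        (\<And>\<phi>. \<phi> \<in> carrier (top_dual V) \<Longrightarrow>
          compose (carrier (fst V)) (\<lambda>e\<in>evaluations V. e \<phi>) A \<in> carrier (top_dual V)) \<Longrightarrow>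
        continuous_map (snd V) T A"
    and hom': "\<And>B. B \<in> linear_maps (bidual V) (fst V) \<Longrightarrow>
        (\<And>\<phi>. \<phi> \<in> carrier (top_dual V) \<Longrightarrow>
          compose (evaluations V) \<phi> B \<in> (\<lambda>\<phi>. \<lambda>e\<in>evaluations V. e \<phi>) ` carrier (top_dual V)) \<Longrightarrow>
        continuous_map T (snd V) B"
  shows "tvs_iso V (bidual V, T) (double_dual_eval V)"
proof -
  have ks: "kspace (fst V)" using V by (cases V) (auto simp: TVS_iff kspace_def lctvsD(1))
  let ?A = "double_dual_eval V"
  note A = double_dual_eval_linear[OF V]
  obtain B where B: "B \<in> linear_maps (bidual V) (fst V)" "\<And>x. x \<in> carrier (fst V) \<Longrightarrow> B (?A x) = x"
    "\<And>y. y \<in> carrier (bidual V) \<Longrightarrow> ?A (B y) = y"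
    using linear_maps_inverse[OF ks A double_dual_eval_bij[OF V]] by blast
  have AE: "?A x \<in> evaluations V" if "x \<in> carrier (fst V)" for x
    using linear_mapsD(1)[OF A that] by simp
  have BC: "B e \<in> carrier (fst V)" if "e \<in> evaluations V" for e
    using linear_mapsD(1)[OF B(1), of e] that by simp
  have "continuous_map (snd V) T ?A"
  proof (rule hom[OF A])
    fix \<phi> assume \<phi>: "\<phi> \<in> carrier (top_dual V)"
    \<comment> \<open>Composed with the canonical map, evaluation at \<open>\<phi>\<close> is
      \<open>\<phi>\<close> itself.\<close>
    have "compose (carrier (fst V)) (\<lambda>e\<in>evaluations V. e \<phi>) ?A = \<phi>"
      using \<phi> AE by (intro extensionalityI[OF _ top_dual_extensional])
        (auto simp: compose_def double_dual_eval_def)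
    then show "compose (carrier (fst V)) (\<lambda>e\<in>evaluations V. e \<phi>) ?A \<in> carrier (top_dual V)"
      using \<phi> by simp
  qed
  then have 1: "?A \<in> tvs_hom V (bidual V, T)" using A by (simp add: tvs_hom_iff)
  have "continuous_map T (snd V) B"
  proof (rule hom'[OF B(1)])
    fix \<phi> assume \<phi>: "\<phi> \<in> carrier (top_dual V)"
    \<comment> \<open>Conversely, \<open>e\<close> is evaluation at the point \<open>B e\<close>, so
      \<open>\<phi>\<close> pulled back along \<open>B\<close> is evaluation at
      \<open>\<phi>\<close>.\<close>
    have "\<phi> (B e) = e \<phi>" if "e \<in> evaluations V" for e
      using fun_cong[OF B(3)[of e], of \<phi>] that BC[OF that] \<phi> by (simp add: double_dual_eval_def)
    then have "compose (evaluations V) \<phi> B = (\<lambda>e\<in>evaluations V. e \<phi>)"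
      by (auto simp: compose_def intro!: restrict_ext)
    then show "compose (evaluations V) \<phi> B \<in> (\<lambda>\<phi>. \<lambda>e\<in>evaluations V. e \<phi>) ` carrier (top_dual V)"
      using \<phi> by simp
  qed
  then have 2: "B \<in> tvs_hom (bidual V, T) V" using B(1) by (simp add: tvs_hom_iff)
  have "tvs_comp V B ?A = tvs_id V" "tvs_comp (bidual V, T) ?A B = tvs_id (bidual V, T)"
    using B(2,3) by (auto simp: tvs_comp_def tvs_id_def compose_def intro!: restrict_ext)
  with 1 2 show ?thesis unfolding tvs_iso_def by blast
qed

text \<open>These functionals define the topology of the double dual; the right-hand side has the
  form required by \<open>double_dual_eval_iso\<close>.\<close>

lemma evaluations_D:
  assumes "fst D = top_dual V" "top_dual D = bidual V"
  shows "evaluations D = (\<lambda>\<phi>. \<lambda>e\<in>evaluations V. e \<phi>) ` carrier (top_dual V)"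
  using assms by (simp add: evaluations_def[of D])

text \<open>The topology of \<open>V\<close> is itself a \<open>weak_top\<close>, so
  \<open>continuous_map_weak_top\<close> serves in both directions; its condition on functionals is
  the one passed on by \<open>double_dual_eval_iso\<close>, rewritten with \<open>E\<close>.\<close>

lemma double_dual_iso_w:
  assumes "V \<in> TVS_w"
  shows "tvs_iso V (D_w (D_w V)) (double_dual_eval V)"
proof -
  have V: "V \<in> TVS" and sV: "snd V = weak_top (fst V) (carrier (top_dual V))"
    using assms TVS_w_iff[of "fst V" "snd V"] by auto
  note D = D_w_TVS[OF V]
  note E = evaluations_D[OF D(3,4)]
  have p: "dual_pair (fst V) (carrier (top_dual V))" using dual_pair_top_dual[of "fst V" "snd V"] V by simp
  have q: "dual_pair (bidual V) (evaluations (D_w V))" using dual_pair_evaluations[OF D(1)] D(4) by simp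
  have "tvs_iso V (bidual V, weak_top (bidual V) (evaluations (D_w V))) (double_dual_eval V)"
  proof (rule double_dual_eval_iso[OF V])
    show "continuous_map (snd V) (weak_top (bidual V) (evaluations (D_w V))) A"
      if "A \<in> linear_maps (fst V) (bidual V)" "\<And>\<phi>. \<phi> \<in> carrier (top_dual V) \<Longrightarrow>
          compose (carrier (fst V)) (\<lambda>e\<in>evaluations V. e \<phi>) A \<in> carrier (top_dual V)" for A
      unfolding sV using that(2) by (intro continuous_map_weak_top[OF p q that(1)]) (auto simp: E)
    show "continuous_map (weak_top (bidual V) (evaluations (D_w V))) (snd V) B"
      if "B \<in> linear_maps (bidual V) (fst V)" "\<And>\<phi>. \<phi> \<in> carrier (top_dual V) \<Longrightarrow>
          compose (evaluations V) \<phi> B \<in> (\<lambda>\<phi>. \<lambda>e\<in>evaluations V. e \<phi>) ` carrier (top_dual V)" for B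
      unfolding sV using that(2) by (intro continuous_map_weak_top[OF q p that(1)]) (simp add: E)
  qed
  then show ?thesis using D_w_eq[OF D(1)] D(4) by simp
qed

lemma double_dual_iso_m:
  assumes "V \<in> TVS_m"
  shows "tvs_iso V (D_m (D_m V)) (double_dual_eval V)"
proof -
  have V: "V \<in> TVS" and sV: "snd V = mackey_top (fst V) (carrier (top_dual V))"
    using assms TVS_m_iff[of "fst V" "snd V"] by auto
  note D = D_m_TVS[OF V]
  note E = evaluations_D[OF D(3,4)]
  have p: "dual_pair (fst V) (carrier (top_dual V))" using dual_pair_top_dual[of "fst V" "snd V"] V by simp
  have q: "dual_pair (bidual V) (evaluations (D_m V))" using dual_pair_evaluations[OF D(1)] D(4) by simp
  have "tvs_iso V (bidual V, mackey_top (bidual V) (evaluations (D_m V))) (double_dual_eval V)"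
  proof (rule double_dual_eval_iso[OF V])
    show "continuous_map (snd V) (mackey_top (bidual V) (evaluations (D_m V))) A"
      if "A \<in> linear_maps (fst V) (bidual V)" "\<And>\<phi>. \<phi> \<in> carrier (top_dual V) \<Longrightarrow>
          compose (carrier (fst V)) (\<lambda>e\<in>evaluations V. e \<phi>) A \<in> carrier (top_dual V)" for A
      unfolding sV using that(2) by (intro continuous_map_mackey_top[OF p q that(1)]) (auto simp: E)
    show "continuous_map (mackey_top (bidual V) (evaluations (D_m V))) (snd V) B"
      if "B \<in> linear_maps (bidual V) (fst V)" "\<And>\<phi>. \<phi> \<in> carrier (top_dual V) \<Longrightarrow>
          compose (evaluations V) \<phi> B \<in> (\<lambda>\<phi>. \<lambda>e\<in>evaluations V. e \<phi>) ` carrier (top_dual V)" for B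
      unfolding sV using that(2) by (intro continuous_map_mackey_top[OF q p that(1)]) (simp add: E)
  qed
  then show ?thesis using D_m_eq[OF D(1)] D(4) by simp
qed

section \<open>Functors, duality formulas and natural isomorphisms\<close>

lemma TVS_w_TVS: "V \<in> TVS_w \<Longrightarrow> V \<in> TVS"
  by (simp add: TVS_w_def)

lemma TVS_m_TVS: "V \<in> TVS_m \<Longrightarrow> V \<in> TVS"
  by (simp add: TVS_m_def)

lemma D_w_mor_eq: "D_w_mor V W f = transpose_map V W f"
  by (simp add: D_w_mor_def R_chu_mor_def T_chu_mor_def)

lemma D_m_mor_eq: "D_m_mor V W f = transpose_map V W f"
  by (simp add: D_m_mor_def L_chu_mor_def T_chu_mor_def)

theorem lemma4p3p4:
  shows
    "(\<forall>V :: ('k::real_or_complex, 'a) tvs. V \<in> TVS_w \<longrightarrow> D_w V \<in> TVS_w) \<and>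
     (\<forall>(V :: ('k, 'a) tvs) (W :: ('k, 'b) tvs) f. V \<in> TVS_w \<and> W \<in> TVS_w \<and> f \<in> tvs_hom V W \<longrightarrow>
          D_w_mor V W f \<in> tvs_hom (D_w W) (D_w V)) \<and>
     (\<forall>V :: ('k, 'a) tvs. V \<in> TVS_w \<longrightarrow> D_w_mor V V (tvs_id V) = tvs_id (D_w V)) \<and>
     (\<forall>(U :: ('k, 'a) tvs) (V :: ('k, 'b) tvs) (W :: ('k, 'c) tvs) f g.
          U \<in> TVS_w \<and> V \<in> TVS_w \<and> W \<in> TVS_w \<and> f \<in> tvs_hom U V \<and> g \<in> tvs_hom V W \<longrightarrow>
          D_w_mor U W (tvs_comp U g f) = tvs_comp (D_w W) (D_w_mor U V f) (D_w_mor V W g)) \<and>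
     (\<forall>V :: ('k, 'a) tvs. V \<in> TVS_w \<longrightarrow>
          D_w V = (top_dual V, sigma_top (top_dual V, fst V, \<lambda>\<phi> v. \<phi> v))) \<and>
     (\<forall>V :: ('k, 'a) tvs. V \<in> TVS_w \<longrightarrow> tvs_iso V (D_w (D_w V)) (double_dual_eval V)) \<and>
     (\<forall>(V :: ('k, 'a) tvs) (W :: ('k, 'b) tvs) f. V \<in> TVS_w \<and> W \<in> TVS_w \<and> f \<in> tvs_hom V W \<longrightarrow>
          tvs_comp V (D_w_mor (D_w W) (D_w V) (D_w_mor V W f)) (double_dual_eval V) =
          tvs_comp V (double_dual_eval W) f) \<and>
     (\<forall>V :: ('k::real_or_complex, 'a) tvs. V \<in> TVS_m \<longrightarrow> D_m V \<in> TVS_m) \<and>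
     (\<forall>(V :: ('k, 'a) tvs) (W :: ('k, 'b) tvs) f. V \<in> TVS_m \<and> W \<in> TVS_m \<and> f \<in> tvs_hom V W \<longrightarrow>
          D_m_mor V W f \<in> tvs_hom (D_m W) (D_m V)) \<and>
     (\<forall>V :: ('k, 'a) tvs. V \<in> TVS_m \<longrightarrow> D_m_mor V V (tvs_id V) = tvs_id (D_m V)) \<and>
     (\<forall>(U :: ('k, 'a) tvs) (V :: ('k, 'b) tvs) (W :: ('k, 'c) tvs) f g.
          U \<in> TVS_m \<and> V \<in> TVS_m \<and> W \<in> TVS_m \<and> f \<in> tvs_hom U V \<and> g \<in> tvs_hom V W \<longrightarrow>
          D_m_mor U W (tvs_comp U g f) = tvs_comp (D_m W) (D_m_mor U V f) (D_m_mor V W g)) \<and>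
     (\<forall>V :: ('k, 'a) tvs. V \<in> TVS_m \<longrightarrow>
          D_m V = (top_dual V, tau_top (top_dual V, fst V, \<lambda>\<phi> v. \<phi> v))) \<and>
     (\<forall>V :: ('k, 'a) tvs. V \<in> TVS_m \<longrightarrow> tvs_iso V (D_m (D_m V)) (double_dual_eval V)) \<and>
     (\<forall>(V :: ('k, 'a) tvs) (W :: ('k, 'b) tvs) f. V \<in> TVS_m \<and> W \<in> TVS_m \<and> f \<in> tvs_hom V W \<longrightarrow>
          tvs_comp V (D_m_mor (D_m W) (D_m V) (D_m_mor V W f)) (double_dual_eval V) =
          tvs_comp V (double_dual_eval W) f)"
proof (intro conjI allI impI; (elim conjE)?)
  note w = TVS_w_TVS and m = TVS_m_TVS
  show "D_w V \<in> TVS_w" if "V \<in> TVS_w" for V :: "('k, 'a) tvs"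
    using D_w_TVS(2)[OF w[OF that]] .
  show "D_w_mor V W f \<in> tvs_hom (D_w W) (D_w V)"
    if "V \<in> TVS_w" "W \<in> TVS_w" "f \<in> tvs_hom V W" for V :: "('k, 'a) tvs" and W :: "('k, 'b) tvs" and f
    using transpose_map_D_w[OF w[OF that(1)] w[OF that(2)] that(3)] by (simp add: D_w_mor_eq)
  show "D_w_mor V V (tvs_id V) = tvs_id (D_w V)" if "V \<in> TVS_w" for V :: "('k, 'a) tvs"
    using D_w_TVS(3)[OF w[OF that]] by (simp add: D_w_mor_eq transpose_map_id tvs_id_def[of "D_w V"])
  show "D_w_mor U W (tvs_comp U g f) = tvs_comp (D_w W) (D_w_mor U V f) (D_w_mor V W g)"
    if "U \<in> TVS_w" "V \<in> TVS_w" "W \<in> TVS_w" "f \<in> tvs_hom U V" "g \<in> tvs_hom V W"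
    for U :: "('k, 'a) tvs" and V :: "('k, 'b) tvs" and W :: "('k, 'c) tvs" and f g
    using transpose_map_comp[OF w[OF that(1)] w[OF that(2)] that(4,5)] D_w_TVS(3)[OF w[OF that(3)]]
    by (simp add: D_w_mor_eq tvs_comp_def)
  \<comment> \<open>\<open>chu_dual\<close> swaps the arguments of the evaluation pairing, so the
    formula is \<open>D_w\<close> unfolded.\<close>
  show "D_w V = (top_dual V, sigma_top (top_dual V, fst V, \<lambda>\<phi> v. \<phi> v))" for V :: "('k, 'a) tvs"
    by (simp add: D_w_def R_chu_def T_chu_def)
  show "tvs_iso V (D_w (D_w V)) (double_dual_eval V)" if "V \<in> TVS_w" for V :: "('k, 'a) tvs"
    using that by (rule double_dual_iso_w)
  show "tvs_comp V (D_w_mor (D_w W) (D_w V) (D_w_mor V W f)) (double_dual_eval V) =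
      tvs_comp V (double_dual_eval W) f"
    if "V \<in> TVS_w" "W \<in> TVS_w" "f \<in> tvs_hom V W" for V :: "('k, 'a) tvs" and W :: "('k, 'b) tvs" and f
    using D_w_TVS(3)[OF w[OF that(2)]] D_w_TVS(4)[OF w[OF that(1)]]
    by (simp add: D_w_mor_eq double_dual_eval_natural[OF w[OF that(1)] that(3)])
  show "D_m V \<in> TVS_m" if "V \<in> TVS_m" for V :: "('k, 'a) tvs"
    using D_m_TVS(2)[OF m[OF that]] .
  show "D_m_mor V W f \<in> tvs_hom (D_m W) (D_m V)"
    if "V \<in> TVS_m" "W \<in> TVS_m" "f \<in> tvs_hom V W" for V :: "('k, 'a) tvs" and W :: "('k, 'b) tvs" and f
    using transpose_map_D_m[OF m[OF that(1)] m[OF that(2)] that(3)] by (simp add: D_m_mor_eq)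
  show "D_m_mor V V (tvs_id V) = tvs_id (D_m V)" if "V \<in> TVS_m" for V :: "('k, 'a) tvs"
    using D_m_TVS(3)[OF m[OF that]] by (simp add: D_m_mor_eq transpose_map_id tvs_id_def[of "D_m V"])
  show "D_m_mor U W (tvs_comp U g f) = tvs_comp (D_m W) (D_m_mor U V f) (D_m_mor V W g)"
    if "U \<in> TVS_m" "V \<in> TVS_m" "W \<in> TVS_m" "f \<in> tvs_hom U V" "g \<in> tvs_hom V W"
    for U :: "('k, 'a) tvs" and V :: "('k, 'b) tvs" and W :: "('k, 'c) tvs" and f g
    using transpose_map_comp[OF m[OF that(1)] m[OF that(2)] that(4,5)] D_m_TVS(3)[OF m[OF that(3)]]
    by (simp add: D_m_mor_eq tvs_comp_def)
  show "D_m V = (top_dual V, tau_top (top_dual V, fst V, \<lambda>\<phi> v. \<phi> v))" for V :: "('k, 'a) tvs"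
    by (simp add: D_m_def L_chu_def T_chu_def)
  show "tvs_iso V (D_m (D_m V)) (double_dual_eval V)" if "V \<in> TVS_m" for V :: "('k, 'a) tvs"
    using that by (rule double_dual_iso_m)
  show "tvs_comp V (D_m_mor (D_m W) (D_m V) (D_m_mor V W f)) (double_dual_eval V) =
      tvs_comp V (double_dual_eval W) f"
    if "V \<in> TVS_m" "W \<in> TVS_m" "f \<in> tvs_hom V W" for V :: "('k, 'a) tvs" and W :: "('k, 'b) tvs" and f
    using D_m_TVS(3)[OF m[OF that(2)]] D_m_TVS(4)[OF m[OF that(1)]]
    by (simp add: D_m_mor_eq double_dual_eval_natural[OF m[OF that(1)] that(3)])
qed

end
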